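(* Consider the meteor process on the circular graph $C_k$ in the stationary regime; that is, assume that the distribution of $\mathcal{M}_0=(M^1_0,\dots,M^k_0)$ is the stationary measure $Q$ with total mass $k$. For $i,j\ge1$ and $k\ge i+j+5$, let $A^k_{i,j}$ be the event that $M^2_0=M^{i+3}_0=M^{i+j+4}_0=0$ and $M^n_0>0$ for $n=3,4,\dots,i+2,\ i+4,\dots,i+j+3$. Then $$\mathbb{P}(A^k_{i,j})=\frac{2^{i+j}}{(i+j+5)!}\Bigg[(i+j+4)\Bigg(j\binom{i+j+1}{i-1}+(j+1)\binom{i+j+1}{i}+(i+1)\binom{i+j+1}{i+1}+i\binom{i+j+1}{i+2}-2(i+j+1)\Bigg)+ij\binom{i+j+4}{i+2}\Bigg].$$
   Context: $C_k$ is the circular graph with vertices $1,\dots,k$ and edges $(j,j+1)$, $1\le j\le k-1$, and $(k,1)$. Meteor process on $C_k$ ($k\ge3$): let $N^j$, $1\le j\le k$, be jointly independent rate 1 Poisson processes, independent of the nonnegative initial vector $\mathcal{M}_0$. At a jump time $t$ of $N^j$, $M^j_t=0$ and each of the two neighbors $x$ of $j$ receives half of the mass: $M^x_t=M^x_{t-}+M^j_{t-}/2$; all other masses are unchanged, and masses are constant between jumps. When $\sum_jM^j_0=k$, this Markov process has a unique stationary distribution, denoted $Q$. *)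

theory Defs
  imports "HOL-Probability.Probability"
begin

text \<open>
  Random processes are functions of time and of the sample point: \<open>N t \<omega>\<close>.
  Only times \<open>t \<ge> 0\<close> matter. Path properties are required almost surely.
\<close>

locale poisson_process = prob_space P for P :: "'a measure" +
  fixes rate :: real and N :: "real \<Rightarrow> 'a \<Rightarrow> nat"
  assumes rate_pos: "rate > 0"
    and measurable_N: "\<And>t. t \<ge> 0 \<Longrightarrow> random_variable (count_space UNIV) (N t)"
    and paths: "AE \<omega> in P. N 0 \<omega> = 0 \<and> mono_on {0..} (\<lambda>t. N t \<omega>) \<and>
                  (\<forall>t\<ge>0. continuous (at_right t) (\<lambda>s. N s \<omega>))"
    and increments: "\<And>s t. 0 \<le> s \<Longrightarrow> s < t \<Longrightarrow>
          distr P (count_space UNIV) (\<lambda>\<omega>. N t \<omega> - N s \<omega>)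
            = measure_pmf (poisson_pmf (rate * (t - s)))"
    and indep_increments: "\<And>(t :: nat \<Rightarrow> real) n. 0 \<le> t 0 \<Longrightarrow> strict_mono t \<Longrightarrow>
          indep_vars (\<lambda>_. count_space UNIV) (\<lambda>i \<omega>. N (t (Suc i)) \<omega> - N (t i) \<omega>) {..<n}"

definition jump_time :: "(real \<Rightarrow> nat) \<Rightarrow> real \<Rightarrow> bool" where
  "jump_time n t \<longleftrightarrow> t > 0 \<and> \<not> continuous (at_left t) n"

abbreviation left_limit :: "(real \<Rightarrow> real) \<Rightarrow> real \<Rightarrow> real" where
  "left_limit f t \<equiv> Lim (at_left t) f"

text \<open>The circular graph on the vertices \<open>{1..k}\<close>.\<close>

definition circular_edges :: "nat \<Rightarrow> (nat \<times> nat) set" where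
  "circular_edges k = {(j, j + 1) | j. 1 \<le> j \<and> j \<le> k - 1} \<union> {(k, 1)}"

definition neighbors :: "nat \<Rightarrow> nat \<Rightarrow> nat set" where
  "neighbors k j = {x. (j, x) \<in> circular_edges k \<or> (x, j) \<in> circular_edges k}"

text \<open>
  The deterministic evolution along one realization: \<open>n j t\<close> is the number of meteor hits at
  vertex \<open>j\<close> up to time \<open>t\<close>, and \<open>m t x\<close> is the mass at \<open>x\<close> at time \<open>t\<close>. Constancy is required on
  time intervals \<open>[s, t]\<close> without a jump in \<open>(s, t]\<close>, so a jump at time \<open>s\<close> is already accounted
  for in \<open>m s\<close> and paths are right-continuous. Simultaneous jumps at different vertices
  have probability zero for independent Poisson processes.
\<close>

definition meteor_path :: "nat \<Rightarrow> (nat \<Rightarrow> real \<Rightarrow> nat) \<Rightarrow> (real \<Rightarrow> nat \<Rightarrow> real) \<Rightarrow> bool" where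
  "meteor_path k n m \<longleftrightarrow>
     (\<forall>j\<in>{1..k}. \<forall>t. jump_time (n j) t \<longrightarrow>
        m t j = 0 \<and>
        (\<forall>x\<in>neighbors k j.
           m t x = left_limit (\<lambda>s. m s x) t + left_limit (\<lambda>s. m s j) t / 2) \<and>
        (\<forall>x\<in>{1..k} - insert j (neighbors k j). m t x = left_limit (\<lambda>s. m s x) t)) \<and>
     (\<forall>s t. 0 \<le> s \<and> s < t \<and> (\<forall>j\<in>{1..k}. \<forall>u\<in>{s<..t}. \<not> jump_time (n j) u) \<longrightarrow>
        (\<forall>x\<in>{1..k}. m t x = m s x))"

abbreviation mass_space :: "nat \<Rightarrow> (nat \<Rightarrow> real) measure" where
  "mass_space k \<equiv> PiM {1..k} (\<lambda>_. borel)"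

locale meteor_process = prob_space P for P :: "'a measure" +
  fixes k :: nat
    and N :: "nat \<Rightarrow> real \<Rightarrow> 'a \<Rightarrow> nat"
    and M :: "real \<Rightarrow> 'a \<Rightarrow> nat \<Rightarrow> real"
  assumes k_ge_3: "k \<ge> 3"
    and poisson: "\<And>j. j \<in> {1..k} \<Longrightarrow> poisson_process P 1 (N j)"
    and indep_N: "indep_vars (\<lambda>_. PiM {0..} (\<lambda>_. count_space UNIV))
                    (\<lambda>j \<omega>. \<lambda>t\<in>{0..}. N j t \<omega>) {1..k}"
    and measurable_M: "\<And>t. t \<ge> 0 \<Longrightarrow>
          random_variable (mass_space k) (\<lambda>\<omega>. restrict (M t \<omega>) {1..k})"
    and indep_initial: "indep_set
          (sets (vimage_algebra (space P) (\<lambda>\<omega>. restrict (M 0 \<omega>) {1..k}) (mass_space k)))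
          (sets (vimage_algebra (space P) (\<lambda>\<omega>. \<lambda>(j, t)\<in>{1..k} \<times> {0..}. N j t \<omega>)
                  (PiM ({1..k} \<times> {0..}) (\<lambda>_. count_space UNIV))))"
    and nonneg_initial: "AE \<omega> in P. \<forall>j\<in>{1..k}. M 0 \<omega> j \<ge> 0"
    and evolution: "AE \<omega> in P. meteor_path k (\<lambda>j t. N j t \<omega>) (\<lambda>t. M t \<omega>)"

text \<open>
  The process in the stationary regime with total mass \<open>k\<close>. The case \<open>t = 0\<close> says that the initial
  vector has distribution \<open>Q\<close>; the other cases say that \<open>Q\<close> is invariant under the evolution, that is,
  that \<open>Q\<close> is a stationary distribution. Its uniqueness is not assumed.
\<close>

locale stationary_meteor_process = meteor_process P k N M
  for P :: "'a measure" and k N M +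
  fixes Q :: "(nat \<Rightarrow> real) measure"
  assumes total_mass: "AE \<omega> in P. (\<Sum>j=1..k. M 0 \<omega> j) = real k"
    and stationary: "\<And>t. t \<ge> 0 \<Longrightarrow>
          distr P (mass_space k) (\<lambda>\<omega>. restrict (M t \<omega>) {1..k}) = Q"

end

theory Submission
  imports Defs
begin

text \<open>
  The idea is that the set of empty vertices records nothing but the order of the last hits.
  Once one end of an edge is positive, the two ends are never empty at the same time again: a hit
  that empties one end of the edge makes the other end positive (\<open>edge_stays_nonempty\<close>). Since the
  total mass is positive, this property spreads from one vertex to the whole circle while
  every vertex keeps being hit (\<open>eventually_isolated\<close>). From then on a hit at a neighbour of \<open>x\<close> always
  brings mass to \<open>x\<close>, unless \<open>x\<close> carries mass already, so that \<open>x\<close> is empty if and only if its last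
  hit is later than the last hits of both neighbours (\<open>empty_iff_hit_last\<close>), that is, if \<open>x\<close> is a
  peak of the sequence of last hit times.

  The last hit times before a time \<open>t\<close> are independent, and \<open>exp (last hit - t)\<close> is distributed as
  \<open>max (exp (- t)) u\<close> for a uniform \<open>u\<close>, because \<open>exp (- (t - s))\<close> is the probability of no hit
  in \<open>(s, t]\<close> (\<open>distr_hit_level\<close>). Stationarity allows \<open>t\<close> to be arbitrarily large, and in the limit
  the required probability is the probability that the peaks of \<open>i + j + 5\<close> independent uniform
  variables are, among the interior positions, exactly \<open>2\<close>, \<open>i + 3\<close> and \<open>i + j + 4\<close> (\<open>prob_zero_pattern\<close>).

  Given the value \<open>v\<close> at the middle peak \<open>i + 3\<close>, the variables on its left and on its right are
  independent, and the right side is a mirror image of the left one with \<open>j\<close> in place of \<open>i\<close>.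
  Each side is integrated out one variable at a time from the outer end. The volumes that occur are
  explicit polynomials in \<open>1 + v\<close> and \<open>1 - v\<close> (\<open>emeasure_side_pattern\<close>), and the integral of
  the product of the two side volumes over \<open>v\<close> reduces to Beta integrals with integer exponents
  (\<open>has_integral_side_vol_product\<close>), which yield the binomial coefficients of the theorem.
\<close>

section \<open>Counting paths and their last jump\<close>

definition counting_path :: "(real \<Rightarrow> nat) \<Rightarrow> bool" where
  "counting_path p \<longleftrightarrow> mono_on {0..} p \<and> (\<forall>t\<ge>0. continuous (at_right t) p)"

lemma counting_path_mono: "counting_path p \<Longrightarrow> 0 \<le> s \<Longrightarrow> s \<le> t \<Longrightarrow> p s \<le> p t"
  by (rule mono_onD[of "{0..}" p]) (auto simp: counting_path_def)

lemma counting_path_eventually_right: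
  assumes "counting_path p" "0 \<le> t"
  shows "\<exists>b>t. \<forall>s. t \<le> s \<and> s < b \<longrightarrow> p s = p t"
proof -
  have "eventually (\<lambda>s. p s = p t) (at_right t)"
    using assms by (auto simp: counting_path_def continuous_within tendsto_discrete)
  then obtain b where "b > t" "\<forall>s>t. s < b \<longrightarrow> p s = p t"
    by (auto simp: eventually_at_right_field)
  then show ?thesis by (intro exI[of _ b]) (auto simp: order_le_less)
qed

lemma no_jump_if_constant:
  assumes "counting_path p" "0 \<le> s" "p s = p t" "s < u" "u \<le> t"
  shows "\<not> jump_time p u"
proof -
  have const: "p r = p s" if "s \<le> r" "r \<le> t" for r
  proof (rule antisym)
    show "p r \<le> p s" unfolding assms(3) by (rule counting_path_mono[OF assms(1)]) (use that assms in auto)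
    show "p s \<le> p r" by (rule counting_path_mono[OF assms(1)]) (use that assms in auto)
  qed
  have "p r = p u" if "s \<le> r" "r \<le> u" for r
    using const[of r] const[of u] that assms(4,5) by simp
  then have "\<exists>b<u. \<forall>r>b. r < u \<longrightarrow> p r = p u"
    using \<open>s < u\<close> less_imp_le by blast
  then have "eventually (\<lambda>r. p r = p u) (at_left u)"
    by (simp only: eventually_at_left_field)
  then show ?thesis
    by (auto simp: jump_time_def continuous_within tendsto_discrete)
qed

lemma less_at_jump:
  assumes "counting_path p" "jump_time p u" "0 \<le> r" "r < u"
  shows "p r < p u"
  using no_jump_if_constant[OF assms(1,3), of u u] counting_path_mono[OF assms(1,3), of u] assms
  by force

text \<open>
  The path takes a new natural number at each jump, and none exceeds \<open>p t\<close>. Finiteness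
  is what allows induction along the jumps of a meteor path.
\<close>
lemma finite_jump_times:
  assumes "counting_path p"
  shows "finite {u. jump_time p u \<and> u \<le> t}"
proof (rule finite_imageD)
  show "inj_on p {u. jump_time p u \<and> u \<le> t}"
  proof (rule linorder_inj_onI)
    fix x y assume "x < y" "x \<in> {u. jump_time p u \<and> u \<le> t}" "y \<in> {u. jump_time p u \<and> u \<le> t}"
    then show "p x \<noteq> p y" using less_at_jump[OF assms, of y x] by (auto simp: jump_time_def)
  qed auto
  have "p ` {u. jump_time p u \<and> u \<le> t} \<subseteq> {..p t}"
    using counting_path_mono[OF assms] by (auto simp: jump_time_def)
  then show "finite (p ` {u. jump_time p u \<and> u \<le> t})" by (rule finite_subset) simp
qed

text \<open>
  Only rational times (and \<open>t\<close>) enter the infimum, so that the last hit is a measurable function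
  of the path for the product sigma-algebra. The value \<open>t\<close> for the other times is neutral for the
  infimum. A path without a hit up to \<open>t\<close> has its last hit at \<open>0\<close>.
\<close>
definition last_hit :: "real \<Rightarrow> (real \<Rightarrow> nat) \<Rightarrow> real" where
  "last_hit t p = (INF q\<in>insert t (\<rat> \<inter> {0..t}). if p q = p t then q else t)"

lemma last_hit_bounds:
  assumes "0 \<le> t" shows "0 \<le> last_hit t p" "last_hit t p \<le> t"
proof -
  show "0 \<le> last_hit t p"
    unfolding last_hit_def using assms by (intro cINF_greatest) auto
  have "bdd_below ((\<lambda>q. if p q = p t then q else t) ` insert t (\<rat> \<inter> {0..t}))"
    using assms by (intro bdd_belowI[of _ 0]) auto
  from cINF_lower[OF this, of t] show "last_hit t p \<le> t"
    by (simp add: last_hit_def)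
qed

text \<open>
  By right-continuity, an infimum over rational times decides the event at the
  real time \<open>s\<close> itself.
\<close>
lemma last_hit_le_iff:
  assumes p: "counting_path p" and s: "0 \<le> s" "s \<le> t"
  shows "last_hit t p \<le> s \<longleftrightarrow> p s = p t"
proof
  have bdd: "bdd_below ((\<lambda>q. if p q = p t then q else t) ` insert t (\<rat> \<inter> {0..t}))"
    using s by (intro bdd_belowI[of _ 0]) auto
  show "p s = p t" if le: "last_hit t p \<le> s"
  proof (cases "s = t")
    case False
    then have st: "s < t" using s by simp
    obtain b where b: "b > s" "\<And>r. s \<le> r \<Longrightarrow> r < b \<Longrightarrow> p r = p s"
      using counting_path_eventually_right[OF p s(1)] by blast
    define c where "c = min b t"
    have "last_hit t p < c" using le b st by (simp add: c_def)
    then have "\<exists>q\<in>insert t (\<rat> \<inter> {0..t}). (if p q = p t then q else t) < c"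
      unfolding last_hit_def by (subst (asm) cINF_less_iff[OF _ bdd]) simp_all
    then obtain q where q: "q \<in> insert t (\<rat> \<inter> {0..t})" "(if p q = p t then q else t) < c"
      by blast
    then have q': "p q = p t" "q < c" "0 \<le> q" "q \<le> t" using s by (auto simp: c_def split: if_splits)
    have "p (max q s) = p t"
      using q' s counting_path_mono[OF p, of q "max q s"] counting_path_mono[OF p, of "max q s" t]
      by auto
    moreover have "p (max q s) = p s" using b(1) q' by (intro b(2)) (auto simp: c_def)
    ultimately show ?thesis by simp
  qed simp
  show "last_hit t p \<le> s" if eq: "p s = p t"
  proof (rule dense_ge)
    fix x assume x: "s < x"
    show "last_hit t p \<le> x"
    proof (cases "x \<le> t")
      case True
      obtain q where q: "q \<in> \<rat>" "s < q" "q < x" using Rats_dense_in_real[OF x] by blast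
      have "p s \<le> p q" "p q \<le> p t"
        using q s True by (intro counting_path_mono[OF p]; linarith)+
      then have "p q = p t" using eq by simp
      moreover have "last_hit t p \<le> (if p q = p t then q else t)"
        unfolding last_hit_def using q s True by (intro cINF_lower[OF bdd]) auto
      ultimately show ?thesis using q by auto
    next
      case False
      then show ?thesis using last_hit_bounds(2)[of t p] s by simp
    qed
  qed
qed

lemma last_hit_constant:
  assumes "counting_path p" "0 \<le> t" shows "p (last_hit t p) = p t"
  using last_hit_le_iff[OF assms(1), of "last_hit t p" t] last_hit_bounds[OF assms(2)] by simp

lemma no_jump_after_last_hit:
  assumes "counting_path p" "0 \<le> t" "last_hit t p < u" "u \<le> t"
  shows "\<not> jump_time p u"
  using no_jump_if_constant[OF assms(1) _ last_hit_constant[OF assms(1,2)]] last_hit_bounds assms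
  by auto

lemma jump_at_last_hit:
  assumes p: "counting_path p" and t: "0 \<le> s" "s \<le> t" "p s \<noteq> p t"
  shows "s < last_hit t p" "jump_time p (last_hit t p)"
proof -
  let ?T = "last_hit t p"
  show sT: "s < ?T" using last_hit_le_iff[OF p t(1,2)] t(3) by linarith
  have Tt: "?T \<le> t" using last_hit_bounds t by simp
  show "jump_time p ?T"
  proof (rule ccontr)
    assume "\<not> jump_time p ?T"
    then have "eventually (\<lambda>r. p r = p ?T) (at_left ?T)"
      using sT t by (auto simp: jump_time_def continuous_within tendsto_discrete)
    then obtain b where b: "b < ?T" "\<And>r. b < r \<Longrightarrow> r < ?T \<Longrightarrow> p r = p ?T"
      by (auto simp: eventually_at_left_field)
    define r where "r = (max b s + ?T) / 2"
    have r: "b < r" "r < ?T" "s < r" using b sT by (auto simp: r_def)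
    then have "p r = p t" using b(2)[of r] last_hit_constant[OF p, of t] t by simp
    then show False using last_hit_le_iff[OF p, of r t] r t Tt by auto
  qed
qed

lemma jump_if_increase:
  assumes "counting_path p" "0 \<le> a" "a \<le> b" "p a \<noteq> p b"
  shows "\<exists>u. a < u \<and> u \<le> b \<and> jump_time p u"
  using jump_at_last_hit[OF assms] last_hit_bounds[of b p] assms by auto

section \<open>Meteor paths\<close>

lemma neighbors_interior:
  assumes "1 < x" "x < k" shows "neighbors k x = {x - 1, x + 1}"
  using assms by (auto simp: neighbors_def circular_edges_def)

lemma neighbors_succ:
  assumes "1 \<le> x" "x < k" shows "x + 1 \<in> neighbors k x" "x \<in> neighbors k (x + 1)"
  using assms unfolding neighbors_def circular_edges_def by auto

lemma neighbors_sym: "x \<in> neighbors k y \<Longrightarrow> y \<in> neighbors k x"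
  by (auto simp: neighbors_def)

lemma neighbors_subset: "1 \<le> k \<Longrightarrow> neighbors k x \<subseteq> {1..k}"
  by (auto simp: neighbors_def circular_edges_def)

text \<open>
  The effect of one hit at \<open>j\<close>, with the masses before the hit in \<open>v\<close> and after it in \<open>w\<close>.
\<close>
definition hit :: "nat \<Rightarrow> nat \<Rightarrow> (nat \<Rightarrow> real) \<Rightarrow> (nat \<Rightarrow> real) \<Rightarrow> bool" where
  "hit k j v w \<longleftrightarrow> w j = 0 \<and> (\<forall>x\<in>neighbors k j. w x = v x + v j / 2) \<and>
     (\<forall>x\<in>{1..k} - insert j (neighbors k j). w x = v x)"

locale regular_meteor_path =
  fixes k :: nat and n :: "nat \<Rightarrow> real \<Rightarrow> nat" and m :: "real \<Rightarrow> nat \<Rightarrow> real"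
  assumes k3: "3 \<le> k"
    and counting: "j \<in> {1..k} \<Longrightarrow> counting_path (n j)"
    and path: "meteor_path k n m"
    and init_nonneg: "x \<in> {1..k} \<Longrightarrow> 0 \<le> m 0 x"
begin

definition hits :: "real set" where "hits = {u. \<exists>j\<in>{1..k}. jump_time (n j) u}"

lemma finite_hits: "finite {u\<in>hits. u \<le> t}"
proof -
  have "{u\<in>hits. u \<le> t} = (\<Union>j\<in>{1..k}. {u. jump_time (n j) u \<and> u \<le> t})"
    by (auto simp: hits_def)
  then show ?thesis using finite_jump_times[OF counting] by simp
qed

lemma constant_between_hits:
  assumes "0 \<le> s" "s \<le> t" "\<And>u. s < u \<Longrightarrow> u \<le> t \<Longrightarrow> u \<notin> hits" "x \<in> {1..k}"
  shows "m t x = m s x"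
proof (cases "s = t")
  case False
  then have "\<forall>j\<in>{1..k}. \<forall>u\<in>{s<..t}. \<not> jump_time (n j) u"
    using assms by (auto simp: hits_def)
  moreover have "\<forall>s t. 0 \<le> s \<and> s < t \<and> (\<forall>j\<in>{1..k}. \<forall>u\<in>{s<..t}. \<not> jump_time (n j) u) \<longrightarrow>
      (\<forall>x\<in>{1..k}. m t x = m s x)"
    using path unfolding meteor_path_def by (rule conjunct2)
  moreover have "s < t" using False assms by simp
  ultimately show ?thesis using assms(1,4) by blast
qed simp

text \<open>
  The left limit is attained: the masses are constant from the last hit before \<open>u\<close> (or from \<open>a\<close>,
  if that hit is earlier) up to \<open>u\<close>.
\<close>
lemma hit_at_jump:
  assumes "j \<in> {1..k}" "jump_time (n j) u" "0 \<le> a" "a < u"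
  shows "\<exists>s\<ge>a. s < u \<and> hit k j (m s) (m u)"
proof -
  let ?S = "insert a {r\<in>hits. r \<le> u \<and> a < r \<and> r < u}"
  define s where "s = Max ?S"
  have fin: "finite ?S" by (rule finite_subset[of _ "insert a {r\<in>hits. r \<le> u}"]) (auto intro: finite_hits)
  have sS: "s \<in> ?S" unfolding s_def using fin by (intro Max_in) auto
  then have s: "a \<le> s" "s < u" using assms by auto
  have no: "r \<notin> hits" if "s < r" "r < u" for r
    using Max_ge[OF fin, of r] that s unfolding s_def by auto
  have left: "left_limit (\<lambda>r. m r x) u = m s x" if "x \<in> {1..k}" for x
  proof (rule tendsto_Lim)
    have "m r x = m s x" if "s < r" "r < u" for r
      using that s assms \<open>x \<in> {1..k}\<close> no by (intro constant_between_hits) auto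
    then have "\<exists>b<u. \<forall>r>b. r < u \<longrightarrow> m r x = m s x"
      using s(2) by blast
    then have "eventually (\<lambda>r. m r x = m s x) (at_left u)"
      by (simp only: eventually_at_left_field)
    then show "((\<lambda>r. m r x) \<longlongrightarrow> m s x) (at_left u)"
      by (rule tendsto_eventually)
  qed simp
  have "m u j = 0 \<and>
      (\<forall>x\<in>neighbors k j. m u x = left_limit (\<lambda>r. m r x) u + left_limit (\<lambda>r. m r j) u / 2) \<and>
      (\<forall>x\<in>{1..k} - insert j (neighbors k j). m u x = left_limit (\<lambda>r. m r x) u)"
    using path assms(1,2) unfolding meteor_path_def by blast
  moreover have "left_limit (\<lambda>r. m r x) u = m s x" if "x \<in> neighbors k j" for x
    using left neighbors_subset[of k j] that k3 by auto
  ultimately have "hit k j (m s) (m u)"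
    using left left[OF assms(1)] unfolding hit_def by simp
  with s show ?thesis by blast
qed

text \<open>
  Induction on the number of hits in \<open>(a, t]\<close>. If several vertices are hit at the same
  moment, the update rule of each of them holds, and any one of them can serve for the step.
  Off the circle the masses are arbitrary, which is why \<open>R\<close> has to respect equality on the circle.
\<close>
lemma path_invariant:
  assumes "0 \<le> a" "a \<le> t" "R (m a)"
    and cong: "\<And>v w. (\<And>x. x \<in> {1..k} \<Longrightarrow> v x = w x) \<Longrightarrow> R v \<Longrightarrow> R w"
    and step: "\<And>j u s. j \<in> {1..k} \<Longrightarrow> jump_time (n j) u \<Longrightarrow> a < u \<Longrightarrow> u \<le> t \<Longrightarrow> a \<le> s \<Longrightarrow> s < u
        \<Longrightarrow> hit k j (m s) (m u) \<Longrightarrow> R (m s) \<Longrightarrow> R (m u)"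
  shows "R (m t)"
proof -
  have "R (m t')" if "a \<le> t'" "t' \<le> t" for t'
    using that
  proof (induction "card {u\<in>hits. u \<le> t' \<and> a < u}" arbitrary: t' rule: less_induct)
    case (less t')
    let ?H = "\<lambda>t. {u\<in>hits. u \<le> t \<and> a < u}"
    have fin: "finite (?H r)" for r
      by (rule finite_subset[of _ "{u\<in>hits. u \<le> r}"]) (auto intro: finite_hits)
    show ?case
    proof (cases "?H t' = {}")
      case True
      have "m t' x = m a x" if "x \<in> {1..k}" for x
        using True less.prems assms(1) that by (intro constant_between_hits) auto
      then show ?thesis using cong[of "m a" "m t'"] assms(3) by simp
    next
      case False
      define u where "u = Max (?H t')"
      have u: "u \<in> ?H t'" unfolding u_def using False fin by (intro Max_in)
      then obtain j where j: "j \<in> {1..k}" "jump_time (n j) u" by (auto simp: hits_def)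
      obtain s where s: "a \<le> s" "s < u" "hit k j (m s) (m u)"
        using hit_at_jump[OF j assms(1)] u by blast
      have "?H s \<subseteq> ?H t'" using u s by (intro subsetI) simp
      moreover have "u \<notin> ?H s" using s by simp
      ultimately have "?H s \<subset> ?H t'" using u by blast
      then have "card (?H s) < card (?H t')" using fin by (intro psubset_card_mono)
      from less.hyps[OF this] have "R (m s)" using s u less.prems by auto
      then have Ru: "R (m u)" using step[OF j] u s less.prems by auto
      have "m t' x = m u x" if "x \<in> {1..k}" for x
      proof (rule constant_between_hits)
        fix r assume "u < r" "r \<le> t'"
        then show "r \<notin> hits" using Max_ge[OF fin, of r t'] u unfolding u_def by auto
      qed (use u assms that in auto)
      then show ?thesis using cong[of "m u" "m t'"] Ru by simp
    qed
  qed
  then show ?thesis using assms by blast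
qed

lemma nonneg:
  assumes "0 \<le> t" "x \<in> {1..k}" shows "0 \<le> m t x"
proof -
  have "\<forall>x\<in>{1..k}. 0 \<le> m t x"
  proof (rule path_invariant[where R = "\<lambda>v. \<forall>x\<in>{1..k}. 0 \<le> v x" and a = 0])
    fix j u s assume "j \<in> {1..k}" "hit k j (m s) (m u)" "\<forall>x\<in>{1..k}. 0 \<le> m s x"
    then have "0 \<le> m u x" if "x \<in> {1..k}" for x
      using that unfolding hit_def by (cases "x = j"; cases "x \<in> neighbors k j") auto
    then show "\<forall>x\<in>{1..k}. 0 \<le> m u x" by blast
  qed (use assms init_nonneg in auto)
  with assms show ?thesis by blast
qed

lemma hit_mass_mono:
  assumes "hit k j (m s) (m u)" "0 \<le> s" "j \<in> {1..k}" "x \<in> {1..k}" "x \<noteq> j"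
  shows "m s x \<le> m u x"
  using assms nonneg[of s j] unfolding hit_def by (cases "x \<in> neighbors k j") auto

lemma positive_until_hit:
  assumes "0 \<le> a" "a \<le> t" "0 < m a x" "x \<in> {1..k}"
    and "\<And>u. a < u \<Longrightarrow> u \<le> t \<Longrightarrow> \<not> jump_time (n x) u"
  shows "0 < m t x"
proof (rule path_invariant[where R = "\<lambda>v. 0 < v x" and a = a])
  fix j u s assume *: "j \<in> {1..k}" "jump_time (n j) u" "a < u" "u \<le> t" "a \<le> s" "s < u"
      "hit k j (m s) (m u)" "0 < m s x"
  then have "j \<noteq> x" using assms by auto
  then show "0 < m u x" using hit_mass_mono[of j s u x] * assms by auto
qed (use assms in auto)

lemma zero_until_neighbor_hit:
  assumes "0 \<le> a" "a \<le> t" "m a x = 0" "x \<in> {1..k}"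
    and "\<And>z u. z \<in> neighbors k x \<Longrightarrow> a < u \<Longrightarrow> u \<le> t \<Longrightarrow> \<not> jump_time (n z) u"
  shows "m t x = 0"
proof (rule path_invariant[where R = "\<lambda>v. v x = 0" and a = a])
  fix j u s assume *: "j \<in> {1..k}" "jump_time (n j) u" "a < u" "u \<le> t" "a \<le> s" "s < u"
      "hit k j (m s) (m u)" "m s x = 0"
  then have "j \<notin> neighbors k x" using assms by auto
  then have "x \<notin> neighbors k j" using neighbors_sym by blast
  then show "m u x = 0" using * assms unfolding hit_def by (cases "x = j") auto
qed (use assms in auto)

text \<open>
  A hit of a vertex with positive mass makes both neighbours positive, and it takes a hit at one
  end of the edge to empty that end.
\<close>
lemma edge_stays_nonempty:
  assumes "0 \<le> a" "a \<le> t" "y \<in> neighbors k x" "x \<in> {1..k}" "0 < m a x \<or> 0 < m a y"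
  shows "0 < m t x \<or> 0 < m t y"
proof (rule path_invariant[where R = "\<lambda>v. 0 < v x \<or> 0 < v y" and a = a])
  have y: "y \<in> {1..k}" using assms neighbors_subset[of k x] k3 by auto
  then show "\<And>v w. (\<And>x. x \<in> {1..k} \<Longrightarrow> v x = w x) \<Longrightarrow> 0 < v x \<or> 0 < v y \<Longrightarrow> 0 < w x \<or> 0 < w y"
    using assms by auto
  fix j u s assume *: "j \<in> {1..k}" "jump_time (n j) u" "a < u" "u \<le> t" "a \<le> s" "s < u"
      "hit k j (m s) (m u)" "0 < m s x \<or> 0 < m s y"
  have xy: "x \<in> neighbors k y" using assms neighbors_sym by blast
  have nn: "0 \<le> m s x" "0 \<le> m s y" using nonneg assms * y by auto
  consider (hx) "j = x" | (hy) "j = y" | (other) "j \<noteq> x" "j \<noteq> y" by blast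
  then show "0 < m u x \<or> 0 < m u y"
  proof cases
    case hx
    then have "m u y = m s y + m s x / 2" using * assms unfolding hit_def by auto
    then show ?thesis using nn * by auto
  next
    case hy
    then have "m u x = m s x + m s y / 2" using * xy unfolding hit_def by auto
    then show ?thesis using nn * by auto
  next
    case other
    then have "m s x \<le> m u x" "m s y \<le> m u y"
      using hit_mass_mono[OF *(7) _ *(1)] assms * y by auto
    then show ?thesis using * by auto
  qed
qed (use assms in auto)

definition isolated_if_empty :: "real \<Rightarrow> nat \<Rightarrow> bool" where
  "isolated_if_empty t x \<longleftrightarrow> (\<forall>y\<in>neighbors k x. 0 < m t x \<or> 0 < m t y)"

lemma isolated_mono:
  assumes "isolated_if_empty a x" "0 \<le> a" "a \<le> t" "x \<in> {1..k}"
  shows "isolated_if_empty t x"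
  using assms edge_stays_nonempty unfolding isolated_if_empty_def by blast

text \<open>
  At the first hit after \<open>a\<close> the vertex is still positive, so that this hit gives mass to both
  neighbours.
\<close>
lemma isolated_after_hit_of_positive:
  assumes "0 \<le> a" "a \<le> b" "0 < m a x" "x \<in> {1..k}" "n x a \<noteq> n x b"
  shows "isolated_if_empty b x"
proof -
  let ?J = "{u. jump_time (n x) u \<and> u \<le> b \<and> a < u}"
  have fin: "finite ?J"
    by (rule finite_subset[OF _ finite_jump_times[OF counting[OF assms(4)], of b]]) auto
  define u where "u = Min ?J"
  have "?J \<noteq> {}" using jump_if_increase[OF counting[OF assms(4)] assms(1,2,5)] by blast
  then have u: "u \<in> ?J" unfolding u_def using fin by (intro Min_in)
  obtain s where s: "a \<le> s" "s < u" "hit k x (m s) (m u)"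
    using hit_at_jump[OF assms(4) _ assms(1), of u] u by blast
  have "0 < m s x"
  proof (rule positive_until_hit[OF assms(1) s(1) assms(3,4)])
    fix r assume "a < r" "r \<le> s"
    then show "\<not> jump_time (n x) r" using Min_le[OF fin, of r] s u unfolding u_def by auto
  qed
  moreover have "0 \<le> m s y" if "y \<in> neighbors k x" for y
    using nonneg[of s y] that neighbors_subset[of k x] assms s k3 by auto
  ultimately have "isolated_if_empty u x"
    using s(3) unfolding hit_def isolated_if_empty_def by (auto intro!: add_nonneg_pos)
  then show ?thesis using isolated_mono u assms by auto
qed

text \<open>
  When \<open>x\<close> is hit it becomes empty, so \<open>y\<close> is positive at that moment; the next hit at \<open>y\<close> therefore
  gives mass to both neighbours of \<open>y\<close>.
\<close>
lemma isolated_spreads: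
  assumes "isolated_if_empty a x" "y \<in> neighbors k x" "x \<in> {1..k}" "0 \<le> a" "a \<le> b" "b \<le> c"
    and "n x a \<noteq> n x b" "n y b \<noteq> n y c"
  shows "isolated_if_empty c y"
proof -
  have y: "y \<in> {1..k}" using assms neighbors_subset[of k x] k3 by auto
  obtain u where u: "a < u" "u \<le> b" "jump_time (n x) u"
    using jump_if_increase[OF counting[OF assms(3)] assms(4,5,7)] by blast
  obtain s where "hit k x (m s) (m u)" using hit_at_jump[OF assms(3) u(3) assms(4) u(1)] by blast
  then have "m u x = 0" by (simp add: hit_def)
  moreover have "isolated_if_empty u x" using isolated_mono assms u by auto
  ultimately have pos: "0 < m u y" using assms(2) by (auto simp: isolated_if_empty_def)
  have "n y u \<le> n y b" "n y b \<le> n y c"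
    using counting_path_mono[OF counting[OF y]] u assms by auto
  then have "n y u \<noteq> n y c" using assms by auto
  then show ?thesis using isolated_after_hit_of_positive[of u c y] pos u y assms by auto
qed

text \<open>
  The first window makes the claim true of some positive vertex \<open>y\<close>, and two more windows, with a
  hit of every vertex in each of them, extend it by one step in both directions along the path
  \<open>1, \<dots>, k\<close>. No vertex is more than \<open>k - 1\<close> steps away from \<open>y\<close>.
\<close>
lemma eventually_isolated:
  assumes "0 \<le> h" and pos: "\<exists>y\<in>{1..k}. 0 < m 0 y"
    and act: "\<And>r x. r < 2 * k \<Longrightarrow> x \<in> {1..k} \<Longrightarrow> n x (real r * h) \<noteq> n x (real (Suc r) * h)"
    and x: "x \<in> {1..k}"
  shows "isolated_if_empty (real (2 * k - 1) * h) x"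
proof -
  obtain y where y: "y \<in> {1..k}" "0 < m 0 y" using pos by blast
  have start: "isolated_if_empty h y"
    using isolated_after_hit_of_positive[of 0 h y] y act[of 0 y] assms(1) k3 by auto
  have spread: "isolated_if_empty (real (2 * Suc l + 1) * h) z"
    if iso: "isolated_if_empty (real (2 * l + 1) * h) w" and z: "z \<in> neighbors k w" and w: "w \<in> {1..k}"
      and l: "Suc l < k" for l w z
  proof (rule isolated_spreads[OF iso z w, of "real (2 * l + 2) * h"])
    have "z \<in> {1..k}" using z neighbors_subset[of k w] k3 by auto
    then show "n z (real (2 * l + 2) * h) \<noteq> n z (real (2 * Suc l + 1) * h)"
      using act[of "2 * l + 2" z] l by (simp add: algebra_simps)
    show "n w (real (2 * l + 1) * h) \<noteq> n w (real (2 * l + 2) * h)"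
      using act[of "2 * l + 1" w] w l by (simp add: algebra_simps)
  qed (use assms(1) in \<open>auto intro!: mult_right_mono mult_nonneg_nonneg\<close>)
  have up: "y + l \<le> k \<Longrightarrow> isolated_if_empty (real (2 * l + 1) * h) (y + l)" for l
  proof (induction l)
    case (Suc l)
    then show ?case using spread[of l "y + l" "y + Suc l"] neighbors_succ[of "y + l" k] y by auto
  qed (use start in simp)
  have down: "l < y \<Longrightarrow> isolated_if_empty (real (2 * l + 1) * h) (y - l)" for l
  proof (induction l)
    case (Suc l)
    moreover have "y - Suc l \<in> neighbors k (y - l)"
      using neighbors_succ(2)[of "y - Suc l" k] Suc.prems y by (simp add: Suc_diff_Suc)
    ultimately show ?case using spread[of l "y - l" "y - Suc l"] y by force
  qed (use start in simp)
  define l where "l = (if y \<le> x then x - y else y - x)"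
  have "isolated_if_empty (real (2 * l + 1) * h) x"
    using up[of l] down[of l] x y by (auto simp: l_def split: if_splits)
  moreover have "real (2 * l + 1) * h \<le> real (2 * k - 1) * h"
    using x y assms(1) by (intro mult_right_mono) (auto simp: l_def)
  ultimately show ?thesis using isolated_mono x assms(1) by auto
qed

text \<open>
  The last hit at \<open>x\<close> empties it, and only a later hit at a neighbour can refill it. Conversely, such
  a hit at \<open>z\<close> leaves \<open>x\<close> positive, since \<open>x\<close> and \<open>z\<close> are not both empty before it, and no hit at \<open>x\<close>
  follows. A tie between the last hits of \<open>x\<close> and \<open>z\<close> belongs to this second case.
\<close>
lemma empty_iff_hit_last:
  assumes "0 \<le> a" "a \<le> t" "x \<in> {1..k}" "isolated_if_empty a x"
    and act: "\<And>z. z \<in> {1..k} \<Longrightarrow> n z a \<noteq> n z t"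
  shows "m t x = 0 \<longleftrightarrow> (\<forall>z\<in>neighbors k x. last_hit t (n z) < last_hit t (n x))"
proof
  have t: "0 \<le> t" using assms by simp
  have cp: "counting_path (n z)" if "z \<in> insert x (neighbors k x)" for z
    using that counting neighbors_subset[of k x] assms k3 by auto
  have jump: "a < last_hit t (n z)" "jump_time (n z) (last_hit t (n z))"
    if "z \<in> insert x (neighbors k x)" for z
    using that jump_at_last_hit[OF cp assms(1,2)] act neighbors_subset[of k x] assms k3 by auto
  have nojump: "\<not> jump_time (n z) u" if "z \<in> insert x (neighbors k x)" "last_hit t (n z) < u" "u \<le> t"
    for z u using no_jump_after_last_hit[OF cp t] that by auto
  have le: "last_hit t (n z) \<le> t" for z using last_hit_bounds t by auto
  {
    assume later: "\<forall>z\<in>neighbors k x. last_hit t (n z) < last_hit t (n x)"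
    let ?u = "last_hit t (n x)"
    obtain s where "hit k x (m s) (m ?u)"
      using hit_at_jump[OF assms(3) _ assms(1), of ?u] jump by blast
    then have "m ?u x = 0" by (simp add: hit_def)
    moreover have "\<not> jump_time (n z) v" if "z \<in> neighbors k x" "?u < v" "v \<le> t" for z v
      using nojump[of z v] bspec[OF later that(1)] that by simp
    moreover have "0 \<le> ?u" using jump(1)[of x] assms(1) by simp
    ultimately show "m t x = 0"
      using le assms(3) by (intro zero_until_neighbor_hit[of ?u t x]) blast+
  next
    assume empty: "m t x = 0"
    show "\<forall>z\<in>neighbors k x. last_hit t (n z) < last_hit t (n x)"
    proof (rule ccontr)
      assume "\<not> ?thesis"
      then obtain z where z: "z \<in> neighbors k x" "last_hit t (n x) \<le> last_hit t (n z)" by force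
      let ?u = "last_hit t (n z)"
      have zk: "z \<in> {1..k}" using z neighbors_subset[of k x] k3 by auto
      obtain s where s: "a \<le> s" "hit k z (m s) (m ?u)"
        using hit_at_jump[OF zk _ assms(1), of ?u] jump z by blast
      have "0 < m s x \<or> 0 < m s z"
        using isolated_mono[OF assms(4,1) s(1) assms(3)] z by (auto simp: isolated_if_empty_def)
      moreover have "m ?u x = m s x + m s z / 2"
        using s(2) neighbors_sym[OF z(1)] by (auto simp: hit_def)
      moreover have "0 \<le> m s x" "0 \<le> m s z" using nonneg s assms zk by auto
      ultimately have "0 < m ?u x" by auto
      moreover have "\<not> jump_time (n x) v" if "?u < v" "v \<le> t" for v
        using nojump[of x v] z(2) that by simp
      moreover have "0 \<le> ?u" using jump(1)[of z] z(1) assms(1) by simp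
      ultimately have "0 < m t x"
        using le assms(3) by (intro positive_until_hit[of ?u t x]) blast+
      with empty show False by simp
    qed
  }
qed

end

section \<open>The side volumes and the integral of their product\<close>

text \<open>
  Volumes of the sets of uniform variables that occur between the outer peak of a side and
  the current position. For \<open>rise_vol m a\<close> there are \<open>m\<close> positions up to the outer peak, the current
  value is \<open>a\<close>, and the sequence already increases towards this peak:
  the volume of the chains \<open>a < y\<^sub>1 < \<dots> < y\<^sub>m\<close>, each weighted with the height \<open>y\<^sub>m\<close> of the peak (\<open>a\<close>
  itself if \<open>m = 0\<close>), the probability that the vertex beyond the peak is lower. For \<open>fall_vol m a\<close>
  the sequence has just decreased on arrival at the current position, and there are \<open>m\<close> non-peaks
  before the outer peak, the current position included. The integral \<open>side_vol m v\<close> of \<open>fall_vol m\<close>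
  over \<open>{0..v}\<close> is the volume of a whole side of \<open>m\<close> non-peaks next to a peak of height \<open>v\<close>.
\<close>
definition rise_vol :: "nat \<Rightarrow> real \<Rightarrow> real" where
  "rise_vol m a = (1 - a) ^ m / fact m - (1 - a) ^ Suc m / fact (Suc m)"

definition side_vol :: "nat \<Rightarrow> real \<Rightarrow> real" where
  "side_vol m v = (real m / (real m + 2) * ((1 + v) ^ (m + 2) - (1 - v) ^ (m + 2))
      + (1 + v) * (1 - v) * ((1 + v) ^ m - (1 - v) ^ m)) / (4 * real (m + 1) * fact m)"

text \<open>
  From a descent one can either descend again (first summand, the integral of \<open>fall_vol m\<close> over \<open>{0..a}\<close>)
  or turn upwards (second summand, the integral of \<open>rise_vol m\<close> over \<open>{a..1}\<close>).
\<close>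
fun fall_vol :: "nat \<Rightarrow> real \<Rightarrow> real" where
  "fall_vol 0 a = 0"
| "fall_vol (Suc m) a = side_vol m a + rise_vol (Suc m) a"

lemma rise_vol_0 [simp]: "rise_vol 0 a = a"
  by (simp add: rise_vol_def)

lemma side_vol_0_left [simp]: "side_vol 0 v = 0"
  by (simp add: side_vol_def)

lemma side_vol_0_right [simp]: "side_vol m 0 = 0"
  by (simp add: side_vol_def)

lemma rise_vol_1 [simp]: "rise_vol (Suc m) 1 = 0"
  by (simp add: rise_vol_def)

lemma DERIV_power_fact:
  "((\<lambda>a::real. (1 - a) ^ Suc m / fact (Suc m)) has_real_derivative - ((1 - a) ^ m / fact m)) (at a within S)"
proof -
  have "((\<lambda>a::real. (1 - a) ^ Suc m / fact (Suc m)) has_real_derivative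
      real (Suc m) * ((1 - a) ^ m * - 1) / fact (Suc m)) (at a within S)"
    by (intro DERIV_cdivide) (auto intro!: derivative_eq_intros simp del: power_Suc of_nat_Suc)
  also have "real (Suc m) * ((1 - a) ^ m * - 1) / fact (Suc m) = - ((1 - a) ^ m / fact m)"
    by (simp del: of_nat_Suc)
  finally show ?thesis .
qed

lemma DERIV_rise_vol: "(rise_vol (Suc m) has_real_derivative - rise_vol m a) (at a within S)"
  using DERIV_diff[OF DERIV_power_fact DERIV_power_fact, of m "Suc m" a S]
  by (simp add: rise_vol_def[abs_def] del: power_Suc fact_Suc)

text \<open>
  This verifies the closed form of \<open>side_vol\<close>: with \<open>p = 1 + a\<close> and \<open>q = 1 - a\<close> the derivative of its
  numerator \<open>N\<close> satisfies a recursion that is a polynomial identity modulo \<open>p + q = 2\<close>.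
\<close>
lemma DERIV_side_vol: "(side_vol m has_real_derivative fall_vol m a) (at a within S)"
proof (cases m)
  case 0
  have "side_vol 0 = (\<lambda>_. 0)" by auto
  then show ?thesis using 0 by simp
next
  case (Suc l)
  define N where "N = (\<lambda>l v. real l / (real l + 2) * ((1 + v) ^ (l + 2) - (1 - v) ^ (l + 2))
      + (1 + v) * (1 - v) * ((1 + v) ^ l - (1 - v) ^ l))"
  have side: "side_vol l v = N l v / (4 * real (l + 1) * fact l)" for l v
    by (simp add: side_vol_def N_def)
  \<comment> \<open>Only \<open>c * (l + 3) = l + 1\<close> is needed of \<open>c\<close>; an abstract name keeps the derivative free of quotients.\<close>
  define c where "c = real (Suc l) / (real (Suc l) + 2)"
  have c: "c * (real l + 3) = real l + 1" unfolding c_def by (simp add: divide_simps) (simp add: algebra_simps)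
  have "(N (Suc l) has_real_derivative
      c * ((real l + 3) * (1 + a) ^ (l + 2) + (real l + 3) * (1 - a) ^ (l + 2))
      + ((1 - a) - (1 + a)) * ((1 + a) ^ Suc l - (1 - a) ^ Suc l)
      + (1 + a) * (1 - a) * ((real l + 1) * (1 + a) ^ l + (real l + 1) * (1 - a) ^ l)) (at a within S)"
    unfolding N_def c_def[symmetric]
    by (rule derivative_eq_intros refl | simp del: power_Suc)+ (simp add: algebra_simps)
  also have "c * ((real l + 3) * (1 + a) ^ (l + 2) + (real l + 3) * (1 - a) ^ (l + 2))
      = (real l + 1) * ((1 + a) ^ (l + 2) + (1 - a) ^ (l + 2))"
    unfolding c[symmetric] by (simp only: algebra_simps)
  also have "(real l + 1) * ((1 + a) ^ (l + 2) + (1 - a) ^ (l + 2))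
      + ((1 - a) - (1 + a)) * ((1 + a) ^ Suc l - (1 - a) ^ Suc l)
      + (1 + a) * (1 - a) * ((real l + 1) * (1 + a) ^ l + (real l + 1) * (1 - a) ^ l)
      = real l * ((1 + a) ^ (l + 2) - (1 - a) ^ (l + 2))
        + (real l + 2) * ((1 + a) * (1 - a) * ((1 + a) ^ l - (1 - a) ^ l))
        + 4 * (real l + 2) * (1 - a) ^ Suc l - 4 * (1 - a) ^ Suc (Suc l)"
    by (simp add: algebra_simps)
  also have "\<dots> = (real l + 2) * N l a + 4 * (real l + 2) * (1 - a) ^ Suc l - 4 * (1 - a) ^ Suc (Suc l)"
    by (simp add: N_def distrib_left del: power_Suc)
  finally have *: "(N (Suc l) has_real_derivative (real l + 2) * N l a
      + 4 * (real l + 2) * (1 - a) ^ Suc l - 4 * (1 - a) ^ Suc (Suc l)) (at a within S)" .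
  have "((real l + 2) * N l a + 4 * (real l + 2) * (1 - a) ^ Suc l - 4 * (1 - a) ^ Suc (Suc l))
      / (4 * real (Suc l + 1) * fact (Suc l)) = fall_vol (Suc l) a"
    unfolding fall_vol.simps rise_vol_def side
    by (simp add: divide_simps del: power_Suc) (simp add: algebra_simps del: power_Suc)
  with DERIV_cdivide[OF *, of "4 * real (Suc l + 1) * fact (Suc l)"]
  show ?thesis by (simp only: Suc side[abs_def])
qed

lemma rise_vol_nonneg: assumes "0 \<le> a" "a \<le> 1" shows "0 \<le> rise_vol m a"
proof -
  have "(1 - a) * ((1 - a) ^ m / fact (Suc m)) \<le> 1 * ((1 - a) ^ m / fact m)"
    using assms by (intro mult_mono divide_left_mono) (auto simp: fact_reduce intro!: mult_pos_pos)
  then show ?thesis by (simp add: rise_vol_def)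
qed

lemma fall_vol_nonneg: 
  assumes "0 \<le> a" "a \<le> 1" shows "0 \<le> fall_vol m a"
  using assms
proof (induction m arbitrary: a)
  case (Suc m)
  have "side_vol m 0 \<le> side_vol m a"
    using Suc by (intro DERIV_nonneg_imp_nondecreasing[OF Suc.prems(1)]) (metis DERIV_side_vol order_trans)
  then show ?case using rise_vol_nonneg[of a "Suc m"] Suc.prems by simp
qed simp

lemma has_integral_rise_vol:
  assumes "a \<le> 1" shows "(rise_vol m has_integral rise_vol (Suc m) a) {a..1}"
proof -
  have "(rise_vol m has_integral (- rise_vol (Suc m) 1) - (- rise_vol (Suc m) a)) {a..1}"
    using assms by (intro fundamental_theorem_of_calculus)
     (auto simp: has_real_derivative_iff_has_vector_derivative[symmetric] intro!: derivative_eq_intros DERIV_rise_vol)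
  then show ?thesis by simp
qed

lemma has_integral_fall_vol:
  assumes "0 \<le> a" shows "(fall_vol m has_integral side_vol m a) {0..a}"
proof -
  have "(fall_vol m has_integral side_vol m a - side_vol m 0) {0..a}"
    using assms by (intro fundamental_theorem_of_calculus)
     (auto simp: has_real_derivative_iff_has_vector_derivative[symmetric] intro!: DERIV_side_vol)
  then show ?thesis by simp
qed

text \<open>
  The Beta integral on \<open>{-1..1}\<close>, by integration by parts: each step moves one power from the
  second factor to the first.
\<close>
lemma has_integral_power_product:
  "((\<lambda>v::real. (1 + v) ^ a * (1 - v) ^ b) has_integral 2 ^ (a + b + 1) * fact a * fact b / fact (a + b + 1)) {-1..1}"
proof (induction b arbitrary: a)
  case 0
  have "((\<lambda>v::real. (1 + v) ^ a) has_integral (1 + 1) ^ Suc a / Suc a - (1 + (-1)) ^ Suc a / Suc a) {-1..1}"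
    by (intro fundamental_theorem_of_calculus)
     (auto simp: has_real_derivative_iff_has_vector_derivative[symmetric] field_simps simp del: power_Suc of_nat_Suc intro!: derivative_eq_intros)
  then show ?case by (simp add: fact_reduce[of "Suc a"])
next
  case (Suc b)
  let ?f = "\<lambda>v::real. (1 + v) ^ a * (1 - v) ^ Suc b - (real (Suc b) / real (Suc a)) * ((1 + v) ^ Suc a * (1 - v) ^ b)"
  have "(?f has_integral (1 + 1) ^ Suc a * (1 - 1) ^ Suc b / Suc a - (1 + (-1)) ^ Suc a * (1 - (-1)) ^ Suc b / Suc a) {-1..1}"
    by (intro fundamental_theorem_of_calculus)
     (auto simp: has_real_derivative_iff_has_vector_derivative[symmetric] divide_simps simp del: power_Suc of_nat_Suc intro!: derivative_eq_intros)
  then have "(?f has_integral 0) {-1..1}" by simp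
  note sum = has_integral_add[OF this has_integral_mult_right[OF Suc.IH[of "Suc a"], of "real (Suc b) / real (Suc a)"]]
  have "0 + real (Suc b) / real (Suc a) * (2 ^ (Suc a + b + 1) * fact (Suc a) * fact b / fact (Suc a + b + 1))
      = (2 ^ (a + Suc b + 1) * fact a * fact (Suc b) / fact (a + Suc b + 1) :: real)"
    by (simp add: divide_simps del: of_nat_Suc)
  with sum show ?case by (simp only: diff_add_cancel)
qed

lemma has_integral_half_of_even:
  fixes g :: "real \<Rightarrow> real"
  assumes "(g has_integral I) {-1..1}" "continuous_on {0..1} g" "\<And>v. g (- v) = g v"
  shows "(g has_integral I / 2) {0..1}"
proof -
  obtain J where J: "(g has_integral J) {0..1}"
    using integrable_continuous_interval[OF assms(2)] by (auto simp: integrable_on_def)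
  then have "((\<lambda>v. g (- v)) has_integral J) {-1..-0}"
    by (subst has_integral_reflect_real)
  then have "(g has_integral J + J) {-1..1}"
    using J has_integral_combine[of "-1" 0 1 g J J] by (simp add: assms(3))
  then have "J + J = I" using assms(1) has_integral_unique by blast
  with J show ?thesis by auto
qed

text \<open>
  All factorials beyond \<open>2!\<close> are rational multiples of \<open>(i + 1)!\<close>, \<open>(j + 1)!\<close> and
  \<open>(i + j + 1)!\<close>, which turns the claim into an identity of rational functions of \<open>i\<close> and \<open>j\<close>.
  Up to a common factor, the products \<open>B a b\<close> are the Beta integrals of \<open>has_integral_side_vol_product\<close>.
\<close>
lemma pattern_count_algebra:
  fixes i j :: nat
  assumes "1 \<le> i" "1 \<le> j"
  defines "B \<equiv> \<lambda>a b. (fact a * fact b :: real)"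
  shows "2 * (real i / (real i + 2) * (real j / (real j + 2)) * (B (i + j + 4) 0 - B (i + 2) (j + 2))
           + real i / (real i + 2) * (B (i + j + 3) 1 - B (i + 3) (j + 1))
           + real j / (real j + 2) * (B (i + j + 3) 1 - B (i + 1) (j + 3))
           + (B (i + j + 2) 2 - B (i + 2) (j + 2)))
        = fact (i + 1) * fact (j + 1) *
          (real (i + j + 4) *
              (real j * real ((i + j + 1) choose (i - 1))
               + real (j + 1) * real ((i + j + 1) choose i)
               + real (i + 1) * real ((i + j + 1) choose (i + 1))
               + real i * real ((i + j + 1) choose (i + 2))
               - 2 * real (i + j + 1))
            + real i * real j * real ((i + j + 4) choose (i + 2)))"
proof -
  obtain i' j' where ij: "i = Suc i'" "j = Suc j'" using assms by (metis Suc_le_D One_nat_def)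
  define x y F where "x = real i" and "y = real j" and "F = (fact (i + j + 1) :: real)"
  define u w where "u = (fact (i + 1) :: real)" and "w = (fact (j + 1) :: real)"
  have pos: "x > 0" "y > 0" "F > 0" "u > 0" "w > 0" using assms by (auto simp: x_def y_def F_def u_def w_def)
  have nz: "x \<noteq> 0" "y \<noteq> 0" "x + 1 \<noteq> 0" "y + 1 \<noteq> 0" "x + 2 \<noteq> 0" "y + 2 \<noteq> 0" "u \<noteq> 0" "w \<noteq> 0" using pos by auto
  have fi: "fact i = u / (x + 1)" "fact (i - 1) = u / (x * (x + 1))" "fact (i + 2) = (x + 2) * u" "fact (i + 3) = (x + 3) * (x + 2) * u"
    using ij pos by (simp_all add: u_def x_def numeral_eq_Suc divide_simps) (simp_all add: algebra_simps)?
  have fj: "fact j = w / (y + 1)" "fact (j - 1) = w / (y * (y + 1))" "fact (j + 2) = (y + 2) * w" "fact (j + 3) = (y + 3) * (y + 2) * w"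
    using ij pos by (simp_all add: w_def y_def numeral_eq_Suc divide_simps) (simp_all add: algebra_simps)?
  have step: "(fact (Suc l) :: real) = (real l + 1) * fact l" for l by simp
  have fF: "fact (i + j + 2) = (x + y + 2) * F" "fact (i + j + 3) = (x + y + 3) * ((x + y + 2) * F)"
     "fact (i + j + 4) = (x + y + 4) * ((x + y + 3) * ((x + y + 2) * F))"
  proof -
    have e: "Suc (i + j + 1) = i + j + 2" "Suc (i + j + 2) = i + j + 3" "Suc (i + j + 3) = i + j + 4"
      by simp_all
    have r: "real (i + j + 1) + 1 = x + y + 2" "real (i + j + 2) + 1 = x + y + 3" "real (i + j + 3) + 1 = x + y + 4"
      by (simp_all add: x_def y_def)
    note [simp del] = fact_Suc
    show 2: "fact (i + j + 2) = (x + y + 2) * F"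
      using step[of "i + j + 1"] unfolding e r F_def .
    show 3: "fact (i + j + 3) = (x + y + 3) * ((x + y + 2) * F)"
      using step[of "i + j + 2"] unfolding e r 2 .
    show "fact (i + j + 4) = (x + y + 4) * ((x + y + 3) * ((x + y + 2) * F))"
      using step[of "i + j + 3"] unfolding e r 3 .
  qed
  have d: "i + j + 1 - (i - 1) = j + 2" "i + j + 1 - i = j + 1" "i + j + 1 - (i + 1) = j"
      "i + j + 1 - (i + 2) = j - 1" "i + j + 4 - (i + 2) = j + 2"
    using assms by auto
  have binom: "real (n choose l) = fact n / (fact l * fact (n - l))" if "l \<le> n" for n l
    using binomial_fact[OF that, where 'a = real] .
  have c1: "real ((i + j + 1) choose (i - 1)) = F / (u / (x * (x + 1)) * ((y + 2) * w))"
    using binom[of "i - 1" "i + j + 1"] unfolding d fi fj F_def by simp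
  have c2: "real ((i + j + 1) choose i) = F / (u / (x + 1) * w)"
    using binom[of i "i + j + 1"] unfolding d fi F_def w_def by simp
  have c3: "real ((i + j + 1) choose (i + 1)) = F / (u * (w / (y + 1)))"
    using binom[of "i + 1" "i + j + 1"] unfolding d fj F_def u_def by simp
  have c4: "real ((i + j + 1) choose (i + 2)) = F / ((x + 2) * u * (w / (y * (y + 1))))"
    using binom[of "i + 2" "i + j + 1"] assms unfolding d fi fj F_def by simp
  have c5: "real ((i + j + 4) choose (i + 2)) = (x + y + 4) * ((x + y + 3) * ((x + y + 2) * F)) / ((x + 2) * u * ((y + 2) * w))"
    using binom[of "i + 2" "i + j + 4"] unfolding d fi fj fF by simp
  have num: "real (i + j + 4) = x + y + 4" "real (j + 1) = y + 1" "real (i + 1) = x + 1" "real (i + j + 1) = x + y + 1"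
    by (simp_all add: x_def y_def)
  have f1: "fact 0 = (1::real)" "fact 1 = (1::real)" "fact 2 = (2::real)" by (simp_all add: fact_numeral)
  show ?thesis
    unfolding B_def c1 c2 c3 c4 c5 fF fi fj num u_def[symmetric] w_def[symmetric] x_def[symmetric] y_def[symmetric] f1
    using nz by (simp add: divide_simps) (simp add: algebra_simps)?
qed

text \<open>
  Both side volumes are odd, so their product is even and half of its integral over \<open>{-1..1}\<close> is taken.
  Written in \<open>p = 1 + v\<close> and \<open>q = 1 - v\<close>, the product is homogeneous of degree \<open>i + j + 4\<close>, and all
  its Beta integrals share the factor \<open>V\<close>.
\<close>
lemma has_integral_side_vol_product:
  fixes i j :: nat
  assumes "1 \<le> i" "1 \<le> j"
  shows "((\<lambda>v. side_vol i v * side_vol j v) has_integral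
         2 ^ (i + j) / fact (i + j + 5) *
           (real (i + j + 4) *
              (real j * real ((i + j + 1) choose (i - 1))
               + real (j + 1) * real ((i + j + 1) choose i)
               + real (i + 1) * real ((i + j + 1) choose (i + 1))
               + real i * real ((i + j + 1) choose (i + 2))
               - 2 * real (i + j + 1))
            + real i * real j * real ((i + j + 4) choose (i + 2)))) {0..1}"
    (is "(_ has_integral _ * ?F) _")
proof -
  define c d K where "c = real i / (real i + 2)" and "d = real j / (real j + 2)"
    and "K = 16 * (fact (i + 1) * fact (j + 1) :: real)"
  define B where "B = (\<lambda>a b. (fact a * fact b :: real))"
  define M where "M = (\<lambda>a b (v::real). (1 + v) ^ a * (1 - v) ^ b)"
  define V where "V = (2 ^ (i + j + 5) / fact (i + j + 5) :: real)"
  have M: "(M a b has_integral V * B a b) {-1..1}" if "a + b = i + j + 4" for a b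
  proof -
    have "a + b + 1 = i + j + 5" using that by simp
    from has_integral_power_product[of a b, unfolded this] show ?thesis
      by (simp only: M_def V_def B_def times_divide_eq_left mult.assoc)
  qed
  define G where "G = (\<lambda>v. 
     c * d * (M (i + j + 4) 0 v + M 0 (i + j + 4) v - M (i + 2) (j + 2) v - M (j + 2) (i + 2) v)
     + c * (M (i + j + 3) 1 v + M 1 (i + j + 3) v - M (i + 3) (j + 1) v - M (j + 1) (i + 3) v)
     + d * (M (i + j + 3) 1 v + M 1 (i + j + 3) v - M (j + 3) (i + 1) v - M (i + 1) (j + 3) v)
     + (M (i + j + 2) 2 v + M 2 (i + j + 2) v - M (i + 2) (j + 2) v - M (j + 2) (i + 2) v))"
  define T where "T = c * d * (B (i + j + 4) 0 - B (i + 2) (j + 2))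
           + c * (B (i + j + 3) 1 - B (i + 3) (j + 1))
           + d * (B (i + j + 3) 1 - B (i + 1) (j + 3))
           + (B (i + j + 2) 2 - B (i + 2) (j + 2))"
  have "(G has_integral 
     c * d * (V * B (i + j + 4) 0 + V * B 0 (i + j + 4) - V * B (i + 2) (j + 2) - V * B (j + 2) (i + 2))
     + c * (V * B (i + j + 3) 1 + V * B 1 (i + j + 3) - V * B (i + 3) (j + 1) - V * B (j + 1) (i + 3))
     + d * (V * B (i + j + 3) 1 + V * B 1 (i + j + 3) - V * B (j + 3) (i + 1) - V * B (i + 1) (j + 3))
     + (V * B (i + j + 2) 2 + V * B 2 (i + j + 2) - V * B (i + 2) (j + 2) - V * B (j + 2) (i + 2))) {-1..1}"
      (is "(_ has_integral ?I) _")
    unfolding G_def by (intro has_integral_add has_integral_diff has_integral_mult_right M) auto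
  moreover have "?I = 2 * V * T"
  proof -
    have swap: "B 0 (i + j + 4) = B (i + j + 4) 0" "B (j + 2) (i + 2) = B (i + 2) (j + 2)"
      "B 1 (i + j + 3) = B (i + j + 3) 1" "B (j + 1) (i + 3) = B (i + 3) (j + 1)"
      "B (j + 3) (i + 1) = B (i + 1) (j + 3)" "B 2 (i + j + 2) = B (i + j + 2) 2"
      by (simp_all only: B_def mult.commute)
    show ?thesis unfolding swap T_def by (simp only: algebra_simps)
  qed
  ultimately have "(G has_integral 2 * V * T) {-1..1}" by simp
  moreover have "G (- v) = G v" for v
  proof -
    have "M a b (- v) = M b a v" for a b by (simp add: M_def)
    then show ?thesis unfolding G_def by (simp only: algebra_simps)
  qed
  ultimately have "(G has_integral 2 * V * T / 2) {0..1}"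
    by (intro has_integral_half_of_even) (auto simp: G_def M_def intro!: continuous_intros)
  then have "((\<lambda>v. G v / K) has_integral V * T / K) {0..1}"
    using has_integral_divide[of G "V * T" "{0..1}" K] by simp
  moreover have "G v / K = side_vol i v * side_vol j v" for v
  proof -
    define p q where "p = 1 + v" and "q = 1 - v"
    have "G v = (c * (p ^ (i + 2) - q ^ (i + 2)) + p * q * (p ^ i - q ^ i))
        * (d * (p ^ (j + 2) - q ^ (j + 2)) + p * q * (p ^ j - q ^ j))"
      unfolding G_def M_def p_def[symmetric] q_def[symmetric]
      by (simp add: power_add power2_eq_square power3_eq_cube power4_eq_xxxx) (simp add: algebra_simps)
    moreover have "K = (4 * real (i + 1) * fact i) * (4 * real (j + 1) * fact j)"
      by (simp add: K_def) (simp add: algebra_simps)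
    ultimately show ?thesis
      by (simp add: side_vol_def c_def d_def p_def q_def)
  qed
  moreover have "V * T / K = 2 ^ (i + j) / fact (i + j + 5) * (2 * T / (fact (i + 1) * fact (j + 1)))"
    by (simp add: V_def K_def power_add divide_simps del: fact_Suc)
  moreover have "2 * T / (fact (i + 1) * fact (j + 1)) = ?F"
  proof -
    have "2 * T = fact (i + 1) * fact (j + 1) * ?F"
      unfolding T_def B_def c_def d_def by (rule pattern_count_algebra[OF assms])
    then show ?thesis by (simp only: nonzero_mult_div_cancel_left mult_eq_0_iff fact_nonzero simp_thms)
  qed
  ultimately show ?thesis by (simp only:)
qed

section \<open>Peak patterns of independent uniform variables\<close>

definition is_peak :: "(nat \<Rightarrow> real) \<Rightarrow> nat \<Rightarrow> bool" where
  "is_peak w x \<longleftrightarrow> w (x - 1) < w x \<and> w (x + 1) < w x"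

definition unif :: "real measure" where
  "unif = uniform_measure lborel {0..1}"

lemma sets_unif [simp, measurable_cong]: "sets unif = sets borel"
  by (simp add: unif_def)

lemma space_unif [simp]: "space unif = UNIV"
  by (simp add: unif_def)

lemma prob_space_unif: "prob_space unif"
  unfolding unif_def by (rule prob_space_uniform_measure) auto

lemma nn_integral_unif:
  assumes "f \<in> borel_measurable borel"
  shows "(\<integral>\<^sup>+x. f x \<partial>unif) = (\<integral>\<^sup>+x. f x * indicator {0..1} x \<partial>lborel)"
  unfolding unif_def using assms by (subst nn_integral_uniform_measure) (auto simp: divide_ennreal_def)

lemma nn_integral_indicator_has_integral:
  fixes f :: "real \<Rightarrow> real"
  assumes [measurable]: "f \<in> borel_measurable borel"
    and "\<And>x. x \<in> {c..d} \<Longrightarrow> 0 \<le> f x" and "(f has_integral I) {c..d}"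
  shows "(\<integral>\<^sup>+x. ennreal (f x) * indicator {c..d} x \<partial>lborel) = ennreal I"
proof -
  have "((\<lambda>x. if x \<in> {c..d} then f x else 0) has_integral I) UNIV"
    using assms(3) by (simp only: has_integral_restrict_UNIV)
  then have "(\<integral>\<^sup>+x. ennreal (if x \<in> {c..d} then f x else 0) \<partial>lborel) = ennreal I"
    using assms(2) by (intro nn_integral_has_integral_lborel) auto
  moreover have "(\<lambda>x. ennreal (if x \<in> {c..d} then f x else 0)) = (\<lambda>x. ennreal (f x) * indicator {c..d} x)"
    by (auto simp: fun_eq_iff indicator_def)
  ultimately show ?thesis by simp
qed

abbreviation unif_prod :: "nat set \<Rightarrow> (nat \<Rightarrow> real) measure" where
  "unif_prod I \<equiv> PiM I (\<lambda>_. unif)"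

lemma product_prob_space_unif: "product_prob_space (\<lambda>_::nat. unif)"
  by (rule product_prob_spaceI) (rule prob_space_unif)

lemma pred_fun_upd:
  assumes [measurable]: "Measurable.pred (unif_prod (insert i I)) R"
  shows "Measurable.pred (unif_prod I) (\<lambda>w. R (w(i := y)))"
proof -
  have [measurable]: "(\<lambda>w. w(i := y)) \<in> measurable (unif_prod I) (unif_prod (insert i I))"
    by (rule measurable_fun_upd[where J = I]) auto
  show ?thesis by measurable
qed

lemma emeasure_unif_prod_insert:
  assumes "finite I" "i \<notin> I" and [measurable]: "Measurable.pred (unif_prod (insert i I)) R"
  shows "emeasure (unif_prod (insert i I)) {w \<in> space (unif_prod (insert i I)). R w}
    = (\<integral>\<^sup>+y. emeasure (unif_prod I) {w \<in> space (unif_prod I). R (w(i := y))} \<partial>unif)"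
proof -
  interpret product_prob_space "\<lambda>_::nat. unif" by (rule product_prob_space_unif)
  let ?A = "{w \<in> space (unif_prod (insert i I)). R w}"
  have "emeasure (unif_prod (insert i I)) ?A = (\<integral>\<^sup>+w. indicator ?A w \<partial>unif_prod (insert i I))"
    by simp
  also have "\<dots> = (\<integral>\<^sup>+y. (\<integral>\<^sup>+w. indicator ?A (w(i := y)) \<partial>unif_prod I) \<partial>unif)"
    using assms by (intro product_nn_integral_insert_rev) auto
  also have "\<dots> = (\<integral>\<^sup>+y. emeasure (unif_prod I) {w \<in> space (unif_prod I). R (w(i := y))} \<partial>unif)"
  proof (rule nn_integral_cong)
    fix y
    have [measurable]: "Measurable.pred (unif_prod I) (\<lambda>w. R (w(i := y)))"
      by (rule pred_fun_upd) (rule assms(3))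
    have "(\<integral>\<^sup>+w. indicator ?A (w(i := y)) \<partial>unif_prod I)
        = (\<integral>\<^sup>+w. indicator {w \<in> space (unif_prod I). R (w(i := y))} w \<partial>unif_prod I)"
      by (intro nn_integral_cong) (auto simp: indicator_def space_PiM PiE_iff extensional_def)
    then show "(\<integral>\<^sup>+w. indicator ?A (w(i := y)) \<partial>unif_prod I)
        = emeasure (unif_prod I) {w \<in> space (unif_prod I). R (w(i := y))}"
      by simp
  qed
  finally show ?thesis .
qed

text \<open>
  The pattern of a side is read from the inside to the outside. Position \<open>0\<close> is the outermost vertex,
  position \<open>1\<close> the outer peak, and \<open>tail_pattern l b w\<close> says that the positions \<open>2, \<dots>, l + 1\<close> are
  no peaks and position \<open>1\<close> is one, where the flag \<open>b\<close> tells whether the sequence has just increased on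
  arrival at position \<open>l + 1\<close>. In this form the next variable can be integrated out without reference
  to the earlier ones.
\<close>
fun tail_pattern :: "nat \<Rightarrow> bool \<Rightarrow> (nat \<Rightarrow> real) \<Rightarrow> bool" where
  "tail_pattern 0 b w \<longleftrightarrow> b \<and> w 0 < w 1"
| "tail_pattern (Suc l) b w \<longleftrightarrow>
     \<not> (b \<and> w (l + 1) < w (l + 2)) \<and> tail_pattern l (w (l + 2) < w (l + 1)) w"

lemma tail_pattern_cong:
  "(\<And>x. x \<le> l + 1 \<Longrightarrow> w x = w' x) \<Longrightarrow> tail_pattern l b w = tail_pattern l b w'"
  by (induction l arbitrary: b) auto

lemma tail_pattern_iff:
  "tail_pattern l (w (l + 2) < w (l + 1)) w \<longleftrightarrow>
     is_peak w 1 \<and> (\<forall>x\<in>{2..l + 1}. \<not> is_peak w x)"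
proof (induction l)
  case 0
  then show ?case by (auto simp: is_peak_def numeral_2_eq_2)
next
  case (Suc l)
  have "{2..Suc l + 1} = insert (l + 2) {2..l + 1}" by auto
  then have "(\<forall>x\<in>{2..Suc l + 1}. \<not> is_peak w x) \<longleftrightarrow>
      \<not> is_peak w (l + 2) \<and> (\<forall>x\<in>{2..l + 1}. \<not> is_peak w x)" by simp
  moreover have "is_peak w (l + 2) \<longleftrightarrow> w (l + 3) < w (l + 2) \<and> w (l + 1) < w (l + 2)"
    by (auto simp: is_peak_def numeral_eq_Suc)
  ultimately show ?case using Suc.IH by (auto simp: numeral_eq_Suc)
qed

lemma pred_less_component:
  "x \<in> I \<Longrightarrow> y \<in> I \<Longrightarrow> Measurable.pred (unif_prod I) (\<lambda>w. w x < w y)"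
  by measurable

lemma pred_tail_pattern:
  "{..l + 1} \<subseteq> I \<Longrightarrow> Measurable.pred (unif_prod I) (tail_pattern l b)"
proof (induction l arbitrary: b)
  case 0
  have "Measurable.pred (unif_prod I) (\<lambda>w. w 0 < w 1)"
    by (rule pred_less_component) (use 0 in auto)
  then show ?case by simp
next
  case (Suc l)
  have "{..l + 1} \<subseteq> I" using Suc.prems by auto
  note [measurable] = Suc.IH[OF this, of True] Suc.IH[OF this, of False]
  have [measurable]: "Measurable.pred (unif_prod I) (\<lambda>w. w (l + 1) < w (l + 2))"
      "Measurable.pred (unif_prod I) (\<lambda>w. w (l + 2) < w (l + 1))"
    using Suc.prems by (auto intro!: pred_less_component)
  have "tail_pattern (Suc l) b = (\<lambda>w. \<not> (b \<and> w (l + 1) < w (l + 2)) \<and>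
      (w (l + 2) < w (l + 1) \<and> tail_pattern l True w \<or>
       \<not> w (l + 2) < w (l + 1) \<and> tail_pattern l False w))"
  proof
    fix w show "tail_pattern (Suc l) b w = (\<not> (b \<and> w (l + 1) < w (l + 2)) \<and>
      (w (l + 2) < w (l + 1) \<and> tail_pattern l True w \<or>
       \<not> w (l + 2) < w (l + 1) \<and> tail_pattern l False w))"
      by (cases "w (l + 2) < w (l + 1)") simp_all
  qed
  then show ?case by (simp only:) measurable
qed

lemma borel_measurable_vol [measurable]:
  "rise_vol m \<in> borel_measurable borel" "side_vol m \<in> borel_measurable borel"
  "fall_vol m \<in> borel_measurable borel"
proof -
  show 1: "rise_vol m \<in> borel_measurable borel" for m
    unfolding rise_vol_def[abs_def] by measurable
  show 2: "side_vol m \<in> borel_measurable borel" for m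
    unfolding side_vol_def[abs_def] by measurable
  note [measurable] = 1 2
  show "fall_vol m \<in> borel_measurable borel"
    by (cases m) (simp_all add: fall_vol.simps[abs_def])
qed

text \<open>
  Conditioning on the value \<open>y\<close> at position \<open>l + 1\<close> gives the recursions of \<open>rise_vol\<close> and
  \<open>fall_vol\<close>; a tie \<open>y = a\<close> has probability zero.
\<close>
lemma emeasure_tail_pattern:
  assumes "0 \<le> a" "a \<le> 1"
  shows "emeasure (unif_prod {..<l + 1})
      {w \<in> space (unif_prod {..<l + 1}). tail_pattern l b (w(l + 1 := a))}
    = ennreal (if b then rise_vol l a else fall_vol l a)"
  using assms
proof (induction l arbitrary: a b)
  case 0
  have "emeasure (unif_prod {..<0 + 1}) {w \<in> space (unif_prod {..<0 + 1}). tail_pattern 0 b (w(0 + 1 := a))}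
      = emeasure (unif_prod (insert 0 {})) {w \<in> space (unif_prod (insert 0 {})). b \<and> w 0 < a}"
    by (simp add: lessThan_Suc)
  also have "\<dots> = (\<integral>\<^sup>+y. emeasure (unif_prod {}) {w \<in> space (unif_prod {}). b \<and> (w(0 := y)) 0 < a} \<partial>unif)"
    by (rule emeasure_unif_prod_insert) measurable
  also have "\<dots> = (\<integral>\<^sup>+y. indicator {y. b \<and> y < a} y \<partial>unif)"
    by (intro nn_integral_cong) (auto simp: PiM_empty indicator_def)
  also have "\<dots> = emeasure unif {y. b \<and> y < a}"
    by (rule nn_integral_indicator) measurable
  also have "\<dots> = ennreal (if b then a else 0)"
  proof -
    have "{0..1} \<inter> {y. y < a} = {0..<a}" using 0 by auto
    then show ?thesis using 0 by (auto simp: unif_def divide_ennreal_def)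
  qed
  finally show ?case by simp
next
  case (Suc l)
  let ?R = "\<lambda>w::nat \<Rightarrow> real. tail_pattern (Suc l) b (w(l + 2 := a))"
  have "{..Suc l + 1} \<subseteq> insert (l + 2) (insert (l + 1) {..<l + 1})" by auto
  then have meas: "Measurable.pred (unif_prod (insert (l + 1) {..<l + 1})) ?R"
    by (intro pred_fun_upd pred_tail_pattern)
  have R: "?R (w(l + 1 := y)) \<longleftrightarrow> \<not> (b \<and> y < a) \<and> tail_pattern l (a < y) (w(l + 1 := y))" for w y
    using tail_pattern_cong[of l "w(l + 1 := y, l + 2 := a)" "w(l + 1 := y)"] by auto
  have I: "{..<Suc l + 1} = insert (l + 1) {..<l + 1}" by auto
  let ?g = "\<lambda>y. (if b then ennreal (rise_vol l y) * indicator {a..1} y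
      else ennreal (fall_vol l y) * indicator {0..a} y + ennreal (rise_vol l y) * indicator {a..1} y)"
  have "emeasure (unif_prod {..<Suc l + 1}) {w \<in> space (unif_prod {..<Suc l + 1}). ?R w}
      = (\<integral>\<^sup>+y. emeasure (unif_prod {..<l + 1}) {w \<in> space (unif_prod {..<l + 1}). ?R (w(l + 1 := y))} \<partial>unif)"
    unfolding I by (rule emeasure_unif_prod_insert[OF _ _ meas]) auto
  also have "\<dots> = (\<integral>\<^sup>+y. ?g y \<partial>unif)"
  proof (rule nn_integral_cong_AE)
    have "AE y in unif. y \<in> {0..1} \<and> y \<noteq> a"
      unfolding unif_def using AE_lborel_singleton[of a] by (intro AE_uniform_measureI) auto
    then show "AE y in unif. emeasure (unif_prod {..<l + 1})
        {w \<in> space (unif_prod {..<l + 1}). ?R (w(l + 1 := y))} = ?g y"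
    proof eventually_elim
      case (elim y)
      have "emeasure (unif_prod {..<l + 1})
          {w \<in> space (unif_prod {..<l + 1}). tail_pattern l (a < y) (w(l + 1 := y))}
        = ennreal (if a < y then rise_vol l y else fall_vol l y)"
        by (rule Suc.IH) (use elim in auto)
      then show ?case unfolding R using elim by (cases "b \<and> y < a") (auto simp: indicator_def)
    qed
  qed
  also have "\<dots> = (\<integral>\<^sup>+y. ?g y * indicator {0..1} y \<partial>lborel)"
    by (rule nn_integral_unif) measurable
  also have "\<dots> = (\<integral>\<^sup>+y. ?g y \<partial>lborel)"
    using Suc.prems by (intro nn_integral_cong) (auto simp: indicator_def)
  also have "\<dots> = ennreal (if b then rise_vol (Suc l) a else fall_vol (Suc l) a)"
  proof -
    have rise: "(\<integral>\<^sup>+y. ennreal (rise_vol l y) * indicator {a..1} y \<partial>lborel) = ennreal (rise_vol (Suc l) a)"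
      using Suc.prems by (intro nn_integral_indicator_has_integral has_integral_rise_vol)
        (auto intro!: rise_vol_nonneg)
    have fall: "(\<integral>\<^sup>+y. ennreal (fall_vol l y) * indicator {0..a} y \<partial>lborel) = ennreal (side_vol l a)"
      using Suc.prems by (intro nn_integral_indicator_has_integral has_integral_fall_vol)
        (auto intro!: fall_vol_nonneg)
    have "0 \<le> side_vol l a"
      using has_integral_nonneg[OF has_integral_fall_vol[of a l]] fall_vol_nonneg Suc.prems by auto
    then show ?thesis
      using rise fall rise_vol_nonneg[of a "Suc l"] Suc.prems
      by (cases b) (auto simp: nn_integral_add ennreal_plus)
  qed
  finally have "emeasure (unif_prod {..<Suc l + 1}) {w \<in> space (unif_prod {..<Suc l + 1}). ?R w}
      = ennreal (if b then rise_vol (Suc l) a else fall_vol (Suc l) a)" .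
  moreover have "Suc l + 1 = l + 2" by simp
  ultimately show ?case by (simp only:)
qed

lemma side_vol_nonneg:
  assumes "0 \<le> v" "v \<le> 1" shows "0 \<le> side_vol m v"
  using has_integral_nonneg[OF has_integral_fall_vol[of v m]] fall_vol_nonneg assms by auto

text \<open>
  The positions are counted from the outer end, as in \<open>tail_pattern\<close>, and \<open>m + 2\<close> is the middle peak.
\<close>
definition side_pattern :: "nat \<Rightarrow> (nat \<Rightarrow> real) \<Rightarrow> bool" where
  "side_pattern m w \<longleftrightarrow> w (m + 1) < w (m + 2) \<and> is_peak w 1 \<and> (\<forall>x\<in>{2..m + 1}. \<not> is_peak w x)"

lemma side_pattern_iff_tail_pattern:
  "side_pattern m w \<longleftrightarrow> w (m + 1) < w (m + 2) \<and> tail_pattern m False w"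
proof (cases "w (m + 1) < w (m + 2)")
  case True
  then have "(w (m + 2) < w (m + 1)) = False" by simp
  with True tail_pattern_iff[of m w] show ?thesis by (simp add: side_pattern_def)
qed (simp add: side_pattern_def)

lemma side_pattern_cong:
  assumes "\<And>x. x \<le> m + 2 \<Longrightarrow> w x = w' x"
  shows "side_pattern m w = side_pattern m w'"
  using tail_pattern_cong[of m w w' False] assms by (simp add: side_pattern_iff_tail_pattern)

lemma pred_side_pattern:
  assumes "{..m + 2} \<subseteq> I" shows "Measurable.pred (unif_prod I) (side_pattern m)"
proof -
  have [measurable]: "Measurable.pred (unif_prod I) (tail_pattern m False)"
    using assms by (intro pred_tail_pattern) auto
  have [measurable]: "Measurable.pred (unif_prod I) (\<lambda>w. w (m + 1) < w (m + 2))"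
    using assms by (intro pred_less_component) auto
  show ?thesis unfolding side_pattern_iff_tail_pattern[abs_def] by measurable
qed

lemma emeasure_side_pattern:
  assumes "0 \<le> v" "v \<le> 1"
  shows "emeasure (unif_prod {..<m + 2}) {w \<in> space (unif_prod {..<m + 2}). side_pattern m (w(m + 2 := v))}
    = ennreal (side_vol m v)"
proof -
  let ?R = "\<lambda>w::nat \<Rightarrow> real. side_pattern m (w(m + 2 := v))"
  have "{..m + 2} \<subseteq> insert (m + 2) (insert (m + 1) {..<m + 1})" by auto
  then have meas: "Measurable.pred (unif_prod (insert (m + 1) {..<m + 1})) ?R"
    by (intro pred_fun_upd pred_side_pattern)
  have R: "?R (w(m + 1 := y)) \<longleftrightarrow> y < v \<and> tail_pattern m False (w(m + 1 := y))" for w y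
    using tail_pattern_cong[of m "w(m + 1 := y, m + 2 := v)" "w(m + 1 := y)" False]
    by (auto simp: side_pattern_iff_tail_pattern)
  have I: "{..<m + 2} = insert (m + 1) {..<m + 1}" by auto
  have "emeasure (unif_prod {..<m + 2}) {w \<in> space (unif_prod {..<m + 2}). ?R w}
      = (\<integral>\<^sup>+y. emeasure (unif_prod {..<m + 1}) {w \<in> space (unif_prod {..<m + 1}). ?R (w(m + 1 := y))} \<partial>unif)"
    unfolding I by (rule emeasure_unif_prod_insert[OF _ _ meas]) auto
  also have "\<dots> = (\<integral>\<^sup>+y. ennreal (fall_vol m y) * indicator {0..v} y \<partial>unif)"
  proof (rule nn_integral_cong_AE)
    have "AE y in unif. y \<in> {0..1} \<and> y \<noteq> v"
      unfolding unif_def using AE_lborel_singleton[of v] by (intro AE_uniform_measureI) auto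
    then show "AE y in unif. emeasure (unif_prod {..<m + 1})
        {w \<in> space (unif_prod {..<m + 1}). ?R (w(m + 1 := y))} = ennreal (fall_vol m y) * indicator {0..v} y"
    proof eventually_elim
      case (elim y)
      have "emeasure (unif_prod {..<m + 1})
          {w \<in> space (unif_prod {..<m + 1}). tail_pattern m False (w(m + 1 := y))} = ennreal (fall_vol m y)"
        using emeasure_tail_pattern[of y m False] elim by simp
      then show ?case unfolding R using elim by (cases "y < v") (auto simp: indicator_def)
    qed
  qed
  also have "\<dots> = (\<integral>\<^sup>+y. ennreal (fall_vol m y) * indicator {0..v} y * indicator {0..1} y \<partial>lborel)"
    by (rule nn_integral_unif) measurable
  also have "\<dots> = (\<integral>\<^sup>+y. ennreal (fall_vol m y) * indicator {0..v} y \<partial>lborel)"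
    using assms by (intro nn_integral_cong) (auto simp: indicator_def)
  also have "\<dots> = ennreal (side_vol m v)"
    using assms by (intro nn_integral_indicator_has_integral has_integral_fall_vol)
      (auto intro!: fall_vol_nonneg)
  finally show ?thesis .
qed

text \<open>
  The maps \<open>f\<close> and \<open>g\<close> rename positions, so that both sides of the middle peak can be counted from
  their outer ends.
\<close>
lemma emeasure_unif_prod_Un:
  assumes fin: "finite J" "finite K" and inj: "inj_on f J" "inj_on g K" and disj: "f ` J \<inter> g ` K = {}"
    and [measurable]: "Measurable.pred (unif_prod J) A" "Measurable.pred (unif_prod K) B"
  shows "emeasure (unif_prod (f ` J \<union> g ` K))
      {w \<in> space (unif_prod (f ` J \<union> g ` K)). A (\<lambda>l\<in>J. w (f l)) \<and> B (\<lambda>l\<in>K. w (g l))}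
    = emeasure (unif_prod J) {w \<in> space (unif_prod J). A w} * emeasure (unif_prod K) {w \<in> space (unif_prod K). B w}"
proof -
  interpret product_prob_space "\<lambda>_::nat. unif" by (rule product_prob_space_unif)
  have meas: "(\<lambda>w. \<lambda>l\<in>J. w (f l)) \<in> measurable (unif_prod I) (unif_prod J)" if "f ` J \<subseteq> I" for f J I
    using that by (intro measurable_restrict measurable_component_singleton) auto
  have reindex: "emeasure (unif_prod (f ` J)) {w \<in> space (unif_prod (f ` J)). A (\<lambda>l\<in>J. w (f l))}
      = emeasure (unif_prod J) {w \<in> space (unif_prod J). A w}"
    if "inj_on f J" and [measurable]: "Measurable.pred (unif_prod J) A" for f J A
  proof -
    have [measurable]: "(\<lambda>w. \<lambda>l\<in>J. w (f l)) \<in> measurable (unif_prod (f ` J)) (unif_prod J)"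
      by (rule meas) simp
    have "unif_prod J = distr (unif_prod (f ` J)) (unif_prod J) (\<lambda>w. \<lambda>l\<in>J. w (f l))"
      using distr_PiM_reindex[of "f ` J" "\<lambda>_. unif" f J] that(1) prob_space_unif by simp
    then have "emeasure (unif_prod J) {w \<in> space (unif_prod J). A w}
        = emeasure (distr (unif_prod (f ` J)) (unif_prod J) (\<lambda>w. \<lambda>l\<in>J. w (f l))) {w \<in> space (unif_prod J). A w}"
      by simp
    also have "\<dots> = emeasure (unif_prod (f ` J)) ((\<lambda>w. \<lambda>l\<in>J. w (f l)) -` {w \<in> space (unif_prod J). A w} \<inter> space (unif_prod (f ` J)))"
      by (rule emeasure_distr) measurable
    also have "(\<lambda>w. \<lambda>l\<in>J. w (f l)) -` {w \<in> space (unif_prod J). A w} \<inter> space (unif_prod (f ` J))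
        = {w \<in> space (unif_prod (f ` J)). A (\<lambda>l\<in>J. w (f l))}"
      by (auto simp: space_PiM)
    finally show ?thesis by simp
  qed
  let ?L = "f ` J" and ?R = "g ` K"
  let ?S = "{w \<in> space (unif_prod (?L \<union> ?R)). A (\<lambda>l\<in>J. w (f l)) \<and> B (\<lambda>l\<in>K. w (g l))}"
  let ?SL = "{w \<in> space (unif_prod ?L). A (\<lambda>l\<in>J. w (f l))}" and ?SR = "{w \<in> space (unif_prod ?R). B (\<lambda>l\<in>K. w (g l))}"
  have [measurable]: "(\<lambda>w. \<lambda>l\<in>J. w (f l)) \<in> measurable (unif_prod (?L \<union> ?R)) (unif_prod J)"
      "(\<lambda>w. \<lambda>l\<in>K. w (g l)) \<in> measurable (unif_prod (?L \<union> ?R)) (unif_prod K)"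
      "(\<lambda>w. \<lambda>l\<in>J. w (f l)) \<in> measurable (unif_prod ?L) (unif_prod J)"
      "(\<lambda>w. \<lambda>l\<in>K. w (g l)) \<in> measurable (unif_prod ?R) (unif_prod K)"
    by (auto intro!: meas)
  have S: "?S \<in> sets (unif_prod (?L \<union> ?R))" by measurable
  have SL: "?SL \<in> sets (unif_prod ?L)" and SR: "?SR \<in> sets (unif_prod ?R)" by measurable
  have "emeasure (unif_prod (?L \<union> ?R)) ?S = (\<integral>\<^sup>+w. indicator ?S w \<partial>unif_prod (?L \<union> ?R))"
    using S by simp
  also have "\<dots> = (\<integral>\<^sup>+x. (\<integral>\<^sup>+y. indicator ?S (merge ?L ?R (x, y)) \<partial>unif_prod ?R) \<partial>unif_prod ?L)"
    using fin disj S by (intro product_nn_integral_fold) auto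
  also have "\<dots> = (\<integral>\<^sup>+x. (\<integral>\<^sup>+y. indicator ?SL x * indicator ?SR y \<partial>unif_prod ?R) \<partial>unif_prod ?L)"
  proof (intro nn_integral_cong)
    fix x y assume x: "x \<in> space (unif_prod ?L)" and y: "y \<in> space (unif_prod ?R)"
    have "merge ?L ?R (x, y) \<in> space (unif_prod (?L \<union> ?R))"
      using x y by (auto simp: space_PiM PiE_def extensional_def merge_def)
    moreover have "(\<lambda>l\<in>J. merge ?L ?R (x, y) (f l)) = (\<lambda>l\<in>J. x (f l))"
      by (auto simp: fun_eq_iff merge_def)
    moreover have "(\<lambda>l\<in>K. merge ?L ?R (x, y) (g l)) = (\<lambda>l\<in>K. y (g l))"
      using disj by (auto simp: fun_eq_iff merge_def)
    ultimately show "indicator ?S (merge ?L ?R (x, y)) = (indicator ?SL x * indicator ?SR y :: ennreal)"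
      using x y by (auto simp: indicator_def)
  qed
  also have "\<dots> = emeasure (unif_prod ?L) ?SL * emeasure (unif_prod ?R) ?SR"
    using SL SR by (simp add: nn_integral_cmult nn_integral_multc)
  finally show ?thesis using reindex inj assms by simp
qed

definition three_peaks :: "nat \<Rightarrow> nat \<Rightarrow> (nat \<Rightarrow> real) \<Rightarrow> bool" where
  "three_peaks i j w \<longleftrightarrow> is_peak w 2 \<and> is_peak w (i + 3) \<and> is_peak w (i + j + 4) \<and>
     (\<forall>x\<in>{3..i + 2} \<union> {i + 4..i + j + 3}. \<not> is_peak w x)"

lemma is_peak_shift: "1 \<le> x \<Longrightarrow> is_peak (\<lambda>l. w (l + 1)) x \<longleftrightarrow> is_peak w (x + 1)"
  by (auto simp: is_peak_def)

lemma is_peak_reflect: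
  assumes "1 \<le> x" "x < n" shows "is_peak (\<lambda>l. w (n - l)) x \<longleftrightarrow> is_peak w (n - x)"
proof -
  have "n - (x - 1) = n - x + 1" "n - (x + 1) = n - x - 1" using assms by auto
  then show ?thesis unfolding is_peak_def by metis
qed

text \<open>
  The middle position \<open>i + 3\<close> is the position \<open>i + 2\<close> of the left side and the position \<open>j + 2\<close> of the
  reflected right side; it is a peak because both sides increase towards it.
\<close>
lemma three_peaks_iff_sides:
  "three_peaks i j w \<longleftrightarrow>
     side_pattern i (\<lambda>l. w (l + 1)) \<and> side_pattern j (\<lambda>l. w (i + j + 5 - l))"
proof -
  let ?n = "i + j + 5"
  have "side_pattern i (\<lambda>l. w (l + 1)) \<longleftrightarrow> w (i + 2) < w (i + 3) \<and> is_peak w 2 \<and>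
      (\<forall>x\<in>{2..i + 1}. \<not> is_peak w (x + 1))"
  proof -
    have "is_peak (\<lambda>l. w (l + 1)) 1 \<longleftrightarrow> is_peak w 2"
      by (subst is_peak_shift) (simp_all add: numeral_2_eq_2)
    moreover have "(\<forall>x\<in>{2..i + 1}. \<not> is_peak (\<lambda>l. w (l + 1)) x) \<longleftrightarrow> (\<forall>x\<in>{2..i + 1}. \<not> is_peak w (x + 1))"
      by (intro ball_cong refl arg_cong[where f = Not] is_peak_shift) simp
    ultimately show ?thesis unfolding side_pattern_def by (simp add: numeral_eq_Suc)
  qed
  also have "(\<forall>x\<in>{2..i + 1}. \<not> is_peak w (x + 1)) \<longleftrightarrow> (\<forall>x\<in>(\<lambda>x. x + 1) ` {2..i + 1}. \<not> is_peak w x)"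
    by blast
  also have "(\<lambda>x. x + 1) ` {2..i + 1} = {3..i + 2}"
    by (simp add: image_add_atLeastAtMost')
  finally have L: "side_pattern i (\<lambda>l. w (l + 1)) \<longleftrightarrow> w (i + 2) < w (i + 3) \<and> is_peak w 2 \<and>
      (\<forall>x\<in>{3..i + 2}. \<not> is_peak w x)" .
  have idx: "?n - (j + 1) = i + 4" "?n - (j + 2) = i + 3" "?n - 1 = i + j + 4" by auto
  have "side_pattern j (\<lambda>l. w (?n - l)) \<longleftrightarrow> w (i + 4) < w (i + 3) \<and> is_peak w (i + j + 4) \<and>
      (\<forall>x\<in>{2..j + 1}. \<not> is_peak w (?n - x))"
  proof -
    have "is_peak (\<lambda>l. w (?n - l)) 1 \<longleftrightarrow> is_peak w (i + j + 4)"
      using is_peak_reflect[of 1 ?n w] unfolding idx by simp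
    moreover have "(\<forall>x\<in>{2..j + 1}. \<not> is_peak (\<lambda>l. w (?n - l)) x) \<longleftrightarrow> (\<forall>x\<in>{2..j + 1}. \<not> is_peak w (?n - x))"
      by (intro ball_cong refl arg_cong[where f = Not] is_peak_reflect) simp_all
    ultimately show ?thesis unfolding side_pattern_def idx by blast
  qed
  also have "(\<forall>x\<in>{2..j + 1}. \<not> is_peak w (?n - x)) \<longleftrightarrow> (\<forall>x\<in>(\<lambda>x. ?n - x) ` {2..j + 1}. \<not> is_peak w x)"
    by simp
  also have "(\<lambda>x. ?n - x) ` {2..j + 1} = {i + 4..i + j + 3}"
  proof (intro equalityI subsetI)
    fix y assume "y \<in> {i + 4..i + j + 3}"
    then have "y = ?n - (?n - y)" "?n - y \<in> {2..j + 1}" by auto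
    then show "y \<in> (\<lambda>x. ?n - x) ` {2..j + 1}" by blast
  qed auto
  finally have R: "side_pattern j (\<lambda>l. w (?n - l)) \<longleftrightarrow> w (i + 4) < w (i + 3) \<and> is_peak w (i + j + 4) \<and>
      (\<forall>x\<in>{i + 4..i + j + 3}. \<not> is_peak w x)" .
  have "is_peak w (i + 3) \<longleftrightarrow> w (i + 2) < w (i + 3) \<and> w (i + 4) < w (i + 3)"
    by (simp add: is_peak_def numeral_eq_Suc)
  then show ?thesis unfolding L R three_peaks_def by blast
qed

lemma pred_three_peaks:
  assumes "{1..i + j + 5} \<subseteq> I" shows "Measurable.pred (unif_prod I) (three_peaks i j)"
proof -
  have peak: "Measurable.pred (unif_prod I) (\<lambda>w. is_peak w x)" if "2 \<le> x" "x \<le> i + j + 4" for x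
  proof -
    have [measurable]: "Measurable.pred (unif_prod I) (\<lambda>w. w (x - 1) < w x)"
      "Measurable.pred (unif_prod I) (\<lambda>w. w (x + 1) < w x)"
      using that by (auto intro!: pred_less_component subsetD[OF assms])
    show ?thesis unfolding is_peak_def by measurable
  qed
  note [measurable] = peak[of 2] peak[of "i + 3"] peak[of "i + j + 4"]
  have [measurable]: "Measurable.pred (unif_prod I) (\<lambda>w. \<forall>x\<in>{3..i + 2} \<union> {i + 4..i + j + 3}. \<not> is_peak w x)"
    using assms by (intro pred_intros_finite pred_intros_logic peak) auto
  show ?thesis unfolding three_peaks_def[abs_def] by measurable
qed

lemma emeasure_three_peaks:
  fixes i j :: nat
  assumes "1 \<le> i" "1 \<le> j"
  defines "n \<equiv> i + j + 5"
  shows "emeasure (unif_prod {1..n}) {w \<in> space (unif_prod {1..n}). three_peaks i j w}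
    = (\<integral>\<^sup>+v. ennreal (side_vol i v * side_vol j v) * indicator {0..1} v \<partial>lborel)"
proof -
  define f g where "f = (\<lambda>l::nat. l + 1)" and "g = (\<lambda>l. n - l)"
  let ?J = "{..<i + 2}" and ?K = "{..<j + 2}"
  let ?I = "f ` ?J \<union> g ` ?K"
  have f: "f ` ?J = {1..i + 2}"
  proof (intro equalityI subsetI)
    fix y assume "y \<in> {1..i + 2}"
    then have "y = (y - 1) + 1" "y - 1 \<in> ?J" by auto
    then show "y \<in> f ` ?J" unfolding f_def by blast
  qed (auto simp: f_def)
  have g: "g ` ?K = {i + 4..n}"
  proof (intro equalityI subsetI)
    fix y assume "y \<in> {i + 4..n}"
    then have "y = n - (n - y)" "n - y \<in> ?K" by (auto simp: n_def)
    then show "y \<in> g ` ?K" unfolding g_def by blast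
  qed (auto simp: g_def n_def)
  have inj: "inj_on f ?J" "inj_on g ?K" by (auto simp: f_def g_def n_def inj_on_def)
  have split: "{1..n} = insert (i + 3) ?I" unfolding f g by (auto simp: n_def)
  have meas: "Measurable.pred (unif_prod (insert (i + 3) ?I)) (three_peaks i j)"
    using pred_three_peaks[of i j "{1..n}"] unfolding split[symmetric] n_def by simp
  have "emeasure (unif_prod {1..n}) {w \<in> space (unif_prod {1..n}). three_peaks i j w}
      = (\<integral>\<^sup>+v. emeasure (unif_prod ?I) {w \<in> space (unif_prod ?I). three_peaks i j (w(i + 3 := v))} \<partial>unif)"
    unfolding split by (rule emeasure_unif_prod_insert[OF _ _ meas]) (auto simp: f_def g_def n_def)
  also have "\<dots> = (\<integral>\<^sup>+v. ennreal (side_vol i v * side_vol j v) \<partial>unif)"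
  proof (rule nn_integral_cong_AE)
    have "AE v in unif. v \<in> {0..1}"
      unfolding unif_def by (intro AE_uniform_measureI) auto
    then show "AE v in unif. emeasure (unif_prod ?I) {w \<in> space (unif_prod ?I). three_peaks i j (w(i + 3 := v))}
        = ennreal (side_vol i v * side_vol j v)"
    proof eventually_elim
      case (elim v)
      let ?A = "\<lambda>m (w::nat \<Rightarrow> real). side_pattern m (w(m + 2 := v))"
      have meas': "Measurable.pred (unif_prod {..<m + 2}) (?A m)" for m
        by (intro pred_fun_upd pred_side_pattern) auto
      have "three_peaks i j (w(i + 3 := v)) \<longleftrightarrow> ?A i (\<lambda>l\<in>?J. w (f l)) \<and> ?A j (\<lambda>l\<in>?K. w (g l))" for w
      proof -
        have "side_pattern i (\<lambda>l. (w(i + 3 := v)) (l + 1)) \<longleftrightarrow> ?A i (\<lambda>l\<in>?J. w (f l))"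
          by (rule side_pattern_cong) (auto simp: f_def)
        moreover have "side_pattern j (\<lambda>l. (w(i + 3 := v)) (n - l)) \<longleftrightarrow> ?A j (\<lambda>l\<in>?K. w (g l))"
          by (rule side_pattern_cong) (auto simp: g_def n_def)
        ultimately show ?thesis unfolding three_peaks_iff_sides n_def by blast
      qed
      then have "emeasure (unif_prod ?I) {w \<in> space (unif_prod ?I). three_peaks i j (w(i + 3 := v))}
          = emeasure (unif_prod ?I) {w \<in> space (unif_prod ?I). ?A i (\<lambda>l\<in>?J. w (f l)) \<and> ?A j (\<lambda>l\<in>?K. w (g l))}"
        by simp
      also have "\<dots> = emeasure (unif_prod ?J) {w \<in> space (unif_prod ?J). ?A i w}
          * emeasure (unif_prod ?K) {w \<in> space (unif_prod ?K). ?A j w}"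
        using f g by (intro emeasure_unif_prod_Un inj meas') auto
      also have "\<dots> = ennreal (side_vol i v * side_vol j v)"
      proof -
        have v: "0 \<le> v" "v \<le> 1" using elim by auto
        show ?thesis
          unfolding emeasure_side_pattern[OF v] by (rule ennreal_mult'[symmetric]) (rule side_vol_nonneg[OF v])
      qed
      finally show ?case .
    qed
  qed
  also have "\<dots> = (\<integral>\<^sup>+v. ennreal (side_vol i v * side_vol j v) * indicator {0..1} v \<partial>lborel)"
    by (rule nn_integral_unif) measurable
  finally show ?thesis .
qed

section \<open>Last hits of Poisson processes\<close>

lemma (in poisson_process) AE_counting_path: "AE \<omega> in P. counting_path (\<lambda>t. N t \<omega>)"
  using paths by eventually_elim (auto simp: counting_path_def)

lemma (in poisson_process) event_no_hit:
  assumes "0 \<le> s" "0 \<le> t" shows "{\<omega> \<in> space P. N s \<omega> = N t \<omega>} \<in> events"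
proof -
  have "N r -` {c} \<inter> space P \<in> events" if "0 \<le> r" for r c
    using measurable_N[OF that] by (rule measurable_sets) simp
  then have "(\<Union>c. (N s -` {c} \<inter> space P) \<inter> (N t -` {c} \<inter> space P)) \<in> events"
    using assms by (intro sets.countable_UN sets.Int) auto
  also have "(\<Union>c. (N s -` {c} \<inter> space P) \<inter> (N t -` {c} \<inter> space P)) = {\<omega> \<in> space P. N s \<omega> = N t \<omega>}"
    by auto
  finally show ?thesis .
qed

lemma (in poisson_process) prob_no_hit:
  assumes "0 \<le> s" "s < t"
  shows "prob {\<omega> \<in> space P. N s \<omega> = N t \<omega>} = exp (- rate * (t - s))"
proof -
  have [measurable]: "random_variable (count_space UNIV) (N t)" using assms by (intro measurable_N) auto
  let ?D = "\<lambda>\<omega>. N t \<omega> - N s \<omega>"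
  have D: "random_variable (count_space UNIV) ?D"
    by (rule measurable_compose_countable[where f = "\<lambda>i \<omega>. i - N s \<omega>"])
      (auto intro!: measurable_compose[OF measurable_N[OF assms(1)]])
  have "prob {\<omega> \<in> space P. N s \<omega> = N t \<omega>} = prob (?D -` {0} \<inter> space P)"
  proof (rule measure_eq_AE)
    show "AE \<omega> in P. \<omega> \<in> {\<omega> \<in> space P. N s \<omega> = N t \<omega>} \<longleftrightarrow> \<omega> \<in> ?D -` {0} \<inter> space P"
      using AE_counting_path
    proof eventually_elim
      case (elim \<omega>)
      then show ?case using counting_path_mono[OF elim, of s t] assms by auto
    qed
    show "?D -` {0} \<inter> space P \<in> events" using D by (rule measurable_sets) simp
  qed (use assms in \<open>auto intro: event_no_hit\<close>)
  also have "\<dots> = measure (distr P (count_space UNIV) ?D) {0}"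
    using D by (subst measure_distr) auto
  also have "\<dots> = pmf (poisson_pmf (rate * (t - s))) 0"
    unfolding increments[OF assms] by (simp add: measure_pmf_single)
  also have "\<dots> = exp (- rate * (t - s))"
    using assms rate_pos by simp
  finally show ?thesis .
qed

text \<open>
  The exponential scale makes the law of a last hit uniform, up to an atom for the paths
  without a hit.
\<close>
definition hit_level :: "real \<Rightarrow> (real \<Rightarrow> nat) \<Rightarrow> real" where
  "hit_level t p = exp (last_hit t p - t)"

lemma measurable_hit_level:
  assumes "0 \<le> t"
  shows "hit_level t \<in> borel_measurable (PiM {0..} (\<lambda>_. count_space UNIV))"
proof -
  have "countable (insert t (\<rat> \<inter> {0..t}))"
    using countable_rat by (auto intro: countable_Int1)
  moreover have "(\<lambda>p. if p q = p t then q else t) \<in> borel_measurable (PiM {0..} (\<lambda>_. count_space (UNIV :: nat set)))"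
    if "q \<in> insert t (\<rat> \<inter> {0..t})" for q
  proof -
    have [measurable]: "(\<lambda>p. p q) \<in> measurable (PiM {0..} (\<lambda>_. count_space (UNIV :: nat set))) (count_space UNIV)"
      "(\<lambda>p. p t) \<in> measurable (PiM {0..} (\<lambda>_. count_space (UNIV :: nat set))) (count_space UNIV)"
      using that assms by (auto intro!: measurable_component_singleton)
    show ?thesis by measurable
  qed
  ultimately have "last_hit t \<in> borel_measurable (PiM {0..} (\<lambda>_. count_space UNIV))"
    unfolding last_hit_def[abs_def] by (rule borel_measurable_cINF_real)
  then show ?thesis unfolding hit_level_def[abs_def] by measurable
qed

lemma hit_level_restrict:
  assumes "0 \<le> t" shows "hit_level t (restrict p {0..}) = hit_level t p"
  unfolding hit_level_def last_hit_def using assms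
  by (intro arg_cong[where f = exp] arg_cong2[where f = "(-)"] INF_cong) auto

lemma (in poisson_process) measurable_hit_level_process [measurable]:
  assumes "0 \<le> t" shows "random_variable borel (\<lambda>\<omega>. hit_level t (\<lambda>s. N s \<omega>))"
proof -
  have "random_variable (PiM {0..} (\<lambda>_. count_space UNIV)) (\<lambda>\<omega>. \<lambda>s\<in>{0..}. N s \<omega>)"
    by (intro measurable_restrict measurable_N) simp
  from measurable_compose[OF this measurable_hit_level[OF assms]]
  show ?thesis by (simp add: hit_level_restrict[OF assms])
qed

lemma measure_unif_atMost: "0 \<le> x \<Longrightarrow> x \<le> 1 \<Longrightarrow> measure unif {..x} = x"
proof -
  assume x: "0 \<le> x" "x \<le> 1"
  have "{0..1} \<inter> {..x} = {0..x}" using x by auto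
  then show ?thesis using x by (simp add: unif_def)
qed

text \<open>
  For \<open>exp (- t) \<le> x < 1\<close> the level is at most \<open>x\<close> if and only if there is no hit in \<open>(t + ln x, t]\<close>, which
  has probability \<open>x\<close>. The atom at \<open>exp (- t)\<close>, the event of no hit at all, is what the maximum produces.
\<close>
lemma (in poisson_process) distr_hit_level:
  assumes rate: "rate = 1" and t: "0 \<le> t"
  shows "distr P borel (\<lambda>\<omega>. hit_level t (\<lambda>s. N s \<omega>)) = distr unif borel (max (exp (- t)))"
proof (rule cdf_unique)
  let ?U = "\<lambda>\<omega>. hit_level t (\<lambda>s. N s \<omega>)"
  note [measurable] = measurable_hit_level_process[OF t]
  interpret u: prob_space unif by (rule prob_space_unif)
  show "real_distribution (distr P borel ?U)" "real_distribution (distr unif borel (max (exp (- t))))"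
    by (auto intro!: real_distribution_distr u.real_distribution_distr)
  have bounds: "exp (- t) \<le> ?U \<omega>" "?U \<omega> \<le> 1" for \<omega>
    using last_hit_bounds[OF t] by (auto simp: hit_level_def)
  show "cdf (distr P borel ?U) = cdf (distr unif borel (max (exp (- t))))"
  proof
    fix x
    have L: "cdf (distr P borel ?U) x = prob {\<omega> \<in> space P. ?U \<omega> \<le> x}"
      unfolding cdf_def by (subst measure_distr) (auto intro!: arg_cong[where f = prob])
    have R: "cdf (distr unif borel (max (exp (- t)))) x = measure unif {u. max (exp (- t)) u \<le> x}"
      unfolding cdf_def by (subst measure_distr) (auto intro!: arg_cong[where f = "measure unif"])
    consider (low) "x < exp (- t)" | (high) "1 \<le> x" | (mid) "exp (- t) \<le> x" "x < 1" by linarith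
    then show "cdf (distr P borel ?U) x = cdf (distr unif borel (max (exp (- t)))) x"
    proof cases
      case low
      have "\<not> ?U \<omega> \<le> x" for \<omega> using bounds(1)[of \<omega>] low by linarith
      then have "{\<omega> \<in> space P. ?U \<omega> \<le> x} = {}" by simp
      moreover have "{u. max (exp (- t)) u \<le> x} = {}" using low by auto
      ultimately show ?thesis unfolding L R by (simp only: measure_empty)
    next
      case high
      then have "{\<omega> \<in> space P. ?U \<omega> \<le> x} = space P"
        using bounds(2) by (auto intro: order_trans)
      moreover have "exp (- t) \<le> 1" using t by simp
      then have "exp (- t) \<le> x" using high by linarith
      then have "{u. max (exp (- t)) u \<le> x} = {..x}" by auto
      moreover have "measure unif {..x} = 1"
      proof -
        have "{0..1} \<inter> {..x} = {0..1}" using high by auto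
        then show ?thesis by (simp add: unif_def)
      qed
      ultimately show ?thesis unfolding L R by (simp add: prob_space)
    next
      case mid
      define s where "s = t + ln x"
      have x: "0 < x" using mid exp_gt_zero[of "- t"] by linarith
      have s: "0 \<le> s" "s < t"
        using mid x ln_ge_iff[of x "- t"] by (auto simp: s_def)
      have "prob {\<omega> \<in> space P. ?U \<omega> \<le> x} = prob {\<omega> \<in> space P. N s \<omega> = N t \<omega>}"
      proof (rule measure_eq_AE)
        show "AE \<omega> in P. \<omega> \<in> {\<omega> \<in> space P. ?U \<omega> \<le> x} \<longleftrightarrow> \<omega> \<in> {\<omega> \<in> space P. N s \<omega> = N t \<omega>}"
          using AE_counting_path
        proof eventually_elim
          case (elim \<omega>)
          have "?U \<omega> \<le> x \<longleftrightarrow> last_hit t (\<lambda>s. N s \<omega>) - t \<le> ln x"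
            using x by (simp add: hit_level_def ln_ge_iff)
          also have "\<dots> \<longleftrightarrow> last_hit t (\<lambda>s. N s \<omega>) \<le> s" by (auto simp: s_def)
          also have "\<dots> \<longleftrightarrow> N s \<omega> = N t \<omega>" using last_hit_le_iff[OF elim, of s t] s by simp
          finally show ?case by simp
        qed
        show "{\<omega> \<in> space P. N s \<omega> = N t \<omega>} \<in> events" using s t by (intro event_no_hit)
      qed measurable
      also have "\<dots> = x"
        using prob_no_hit[OF s] x rate by (simp add: s_def)
      finally have "prob {\<omega> \<in> space P. ?U \<omega> \<le> x} = x" .
      moreover have "{u. max (exp (- t)) u \<le> x} = {..x}" using mid by auto
      ultimately show ?thesis unfolding L R using measure_unif_atMost[of x] x mid by simp
    qed
  qed
qed

lemma (in finite_measure) measure_diff_le_AE: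
  assumes "A \<in> sets M" "B \<in> sets M" "C \<in> sets M"
    and "AE x in M. x \<notin> C \<longrightarrow> (x \<in> A \<longleftrightarrow> x \<in> B)"
  shows "\<bar>measure M A - measure M B\<bar> \<le> measure M C"
proof -
  have "measure M A \<le> measure M (B \<union> C)" "measure M B \<le> measure M (A \<union> C)"
    using assms by (auto intro!: finite_measure_mono_AE elim!: eventually_mono)
  moreover have "measure M (B \<union> C) \<le> measure M B + measure M C" "measure M (A \<union> C) \<le> measure M A + measure M C"
    using assms by (auto intro!: measure_Un_le)
  ultimately show ?thesis by linarith
qed

text \<open>
  The two vectors differ only if some coordinate is below \<open>e\<close>.
\<close>
lemma unif_prod_max_close:
  assumes "finite I" and R: "Measurable.pred (unif_prod I) R" and e: "0 \<le> e" "e \<le> 1"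
  shows "\<bar>measure (unif_prod I) {w \<in> space (unif_prod I). R (compose I (max e) w)}
      - measure (unif_prod I) {w \<in> space (unif_prod I). R w}\<bar> \<le> real (card I) * e"
proof -
  interpret product_prob_space "\<lambda>_::nat. unif" by (rule product_prob_space_unif)
  interpret prob_space "unif_prod I" by (intro prob_space_PiM prob_space_unif)
  note [measurable] = R
  have [measurable]: "(\<lambda>w. compose I (max e) w) \<in> measurable (unif_prod I) (unif_prod I)"
    unfolding compose_def by (intro measurable_restrict) measurable
  let ?C = "\<lambda>x. {w \<in> space (unif_prod I). w x \<le> e}"
  have C: "?C x \<in> sets (unif_prod I)" "prob (?C x) = e" if "x \<in> I" for x
  proof -
    have [measurable]: "(\<lambda>w. w x) \<in> measurable (unif_prod I) unif"
      using that by (rule measurable_component_singleton)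
    show "?C x \<in> sets (unif_prod I)" by measurable
    have "e = measure (distr (unif_prod I) unif (\<lambda>w. w x)) {..e}"
      using PiM_component[OF that] measure_unif_atMost[OF e] by simp
    also have "\<dots> = prob (?C x)"
      by (subst measure_distr) (auto intro!: arg_cong[where f = prob])
    finally show "prob (?C x) = e" by simp
  qed
  have "\<bar>prob {w \<in> space (unif_prod I). R (compose I (max e) w)} - prob {w \<in> space (unif_prod I). R w}\<bar>
      \<le> prob (\<Union>x\<in>I. ?C x)"
  proof (rule measure_diff_le_AE)
    have "R (compose I (max e) w) = R w" if "w \<in> space (unif_prod I)" "w \<notin> (\<Union>x\<in>I. ?C x)" for w
    proof -
      have "compose I (max e) w = w"
        using that by (fastforce simp: compose_def fun_eq_iff space_PiM PiE_def extensional_def)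
      then show ?thesis by simp
    qed
    then show "AE w in unif_prod I. w \<notin> (\<Union>x\<in>I. ?C x) \<longrightarrow>
        (w \<in> {w \<in> space (unif_prod I). R (compose I (max e) w)}) = (w \<in> {w \<in> space (unif_prod I). R w})"
      by (intro AE_I2) blast
    show "(\<Union>x\<in>I. ?C x) \<in> sets (unif_prod I)" using C(1) assms(1) by auto
  qed measurable
  also have "\<dots> \<le> (\<Sum>x\<in>I. prob (?C x))"
    using C(1) assms(1) by (intro finite_measure_subadditive_finite) auto
  also have "\<dots> = real (card I) * e" using C(2) by simp
  finally show ?thesis .
qed

section \<open>The stationary meteor process\<close>

lemma measure_three_peaks:
  fixes i j :: nat
  assumes "1 \<le> i" "1 \<le> j"
  shows "measure (unif_prod {1..i + j + 5}) {w \<in> space (unif_prod {1..i + j + 5}). three_peaks i j w}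
       = integral {0..1} (\<lambda>v. side_vol i v * side_vol j v)"
proof -
  note I = has_integral_side_vol_product[OF assms]
  have nn: "0 \<le> side_vol i v * side_vol j v" if "v \<in> {0..1}" for v
    using that by (simp add: side_vol_nonneg)
  have "emeasure (unif_prod {1..i + j + 5}) {w \<in> space (unif_prod {1..i + j + 5}). three_peaks i j w}
      = ennreal (integral {0..1} (\<lambda>v. side_vol i v * side_vol j v))"
    unfolding emeasure_three_peaks[OF assms]
    by (rule nn_integral_indicator_has_integral) (auto simp: nn has_integral_integrable_integral intro!: has_integral_integrable[OF I] mult_nonneg_nonneg side_vol_nonneg)
  moreover have "0 \<le> integral {0..1} (\<lambda>v. side_vol i v * side_vol j v)"
    using nn by (intro integral_nonneg has_integral_integrable[OF I])
  ultimately show ?thesis by (simp add: measure_def)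
qed

lemma three_peaks_cong:
  assumes "\<And>x. x \<in> {1..i + j + 5} \<Longrightarrow> w x = w' x"
  shows "three_peaks i j w = three_peaks i j w'"
  unfolding three_peaks_iff_sides
  by (intro arg_cong2[where f = "(\<and>)"] side_pattern_cong) (auto intro!: assms)

lemma (in meteor_process) indep_hit_levels:
  assumes "0 \<le> t" "I \<subseteq> {1..k}"
  shows "indep_vars (\<lambda>_. borel) (\<lambda>x \<omega>. hit_level t (\<lambda>s. N x s \<omega>)) I"
proof -
  have "indep_vars (\<lambda>_. borel) (\<lambda>x \<omega>. hit_level t (\<lambda>s\<in>{0..}. N x s \<omega>)) {1..k}"
    using indep_N by (rule indep_vars_compose2) (rule measurable_hit_level[OF assms(1)])
  then have "indep_vars (\<lambda>_. borel) (\<lambda>x \<omega>. hit_level t (\<lambda>s. N x s \<omega>)) {1..k}"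
    by (simp add: hit_level_restrict[OF assms(1)])
  then show ?thesis using assms(2) by (rule indep_vars_subset)
qed

text \<open>
  The independent levels have the joint law of \<open>max (exp (- t))\<close> applied to each coordinate of a uniform
  vector.
\<close>
lemma (in meteor_process) prob_hit_levels:
  assumes t: "0 \<le> t" and I: "I \<subseteq> {1..k}" "I \<noteq> {}" and R: "Measurable.pred (unif_prod I) R"
  shows "prob {\<omega> \<in> space P. R (\<lambda>x\<in>I. hit_level t (\<lambda>s. N x s \<omega>))}
       = measure (unif_prod I) {w \<in> space (unif_prod I). R (compose I (max (exp (- t))) w)}"
    and "{\<omega> \<in> space P. R (\<lambda>x\<in>I. hit_level t (\<lambda>s. N x s \<omega>))} \<in> events"
proof -
  let ?X = "\<lambda>\<omega>. \<lambda>x\<in>I. hit_level t (\<lambda>s. N x s \<omega>)" and ?m = "max (exp (- t))"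
  let ?B = "PiM I (\<lambda>_. borel) :: (nat \<Rightarrow> real) measure"
  have fin: "finite I" using I(1) finite_subset by blast
  have pois: "poisson_process P 1 (N x)" if "x \<in> I" for x using poisson I that by auto
  have rv: "random_variable borel (\<lambda>\<omega>. hit_level t (\<lambda>s. N x s \<omega>))" if "x \<in> I" for x
    by (rule poisson_process.measurable_hit_level_process[OF pois[OF that] t])
  then have X: "random_variable ?B ?X" by (intro measurable_restrict)
  have sets_eq: "sets (unif_prod I) = sets ?B" by (intro sets_PiM_cong) auto
  have space_eq: "space (unif_prod I) = space ?B" using sets_eq by (rule sets_eq_imp_space_eq)
  have SR: "{w \<in> space ?B. R w} \<in> sets ?B"
    using R unfolding sets_eq[symmetric] space_eq[symmetric] by measurable
  have m: "compose I ?m \<in> measurable (unif_prod I) ?B"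
    unfolding compose_def[abs_def] by (intro measurable_restrict) measurable
  have "distr P ?B ?X = PiM I (\<lambda>x. distr P borel (\<lambda>\<omega>. hit_level t (\<lambda>s. N x s \<omega>)))"
    using indep_vars_iff_distr_eq_PiM'[OF I(2), where M' = "\<lambda>_. borel" and X = "\<lambda>x \<omega>. hit_level t (\<lambda>s. N x s \<omega>)"]
      rv indep_hit_levels[OF t I(1)] by blast
  also have "\<dots> = PiM I (\<lambda>_. distr unif borel ?m)"
    using poisson_process.distr_hit_level[OF pois refl t] by (intro PiM_cong) auto
  also have "\<dots> = distr (unif_prod I) (PiM I (\<lambda>_. distr unif borel ?m)) (compose I ?m)"
  proof -
    have "distr (unif_prod I) (PiM I (\<lambda>_. distr unif borel ?m)) (compose I ?m)
        = PiM I (\<lambda>_. distr unif (distr unif borel ?m) ?m)"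
      using fin prob_space_unif
      by (intro distr_PiM_finite_prob_space') (auto intro!: prob_space.prob_space_distr)
    also have "(\<lambda>_. distr unif (distr unif borel ?m) ?m) = (\<lambda>_::nat. distr unif borel ?m)"
      by (auto intro!: distr_cong)
    finally show ?thesis by simp
  qed
  also have "\<dots> = distr (unif_prod I) ?B (compose I ?m)"
    by (intro distr_cong refl sets_PiM_cong) auto
  finally have D: "distr P ?B ?X = distr (unif_prod I) ?B (compose I ?m)" .
  have XS: "?X -` {w \<in> space ?B. R w} \<inter> space P = {\<omega> \<in> space P. R (?X \<omega>)}"
    using measurable_space[OF X] by auto
  have mS: "compose I ?m -` {w \<in> space ?B. R w} \<inter> space (unif_prod I) = {w \<in> space (unif_prod I). R (compose I ?m w)}"
    using measurable_space[OF m] by auto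
  show "{\<omega> \<in> space P. R (?X \<omega>)} \<in> events"
    using measurable_sets[OF X SR] unfolding XS .
  show "prob {\<omega> \<in> space P. R (?X \<omega>)} = measure (unif_prod I) {w \<in> space (unif_prod I). R (compose I ?m w)}"
    using measure_distr[OF X SR] measure_distr[OF m SR] unfolding D XS mS by simp
qed

context stationary_meteor_process
begin

definition zero_pattern :: "nat \<Rightarrow> nat \<Rightarrow> (nat \<Rightarrow> real) \<Rightarrow> bool" where
  "zero_pattern i j v \<longleftrightarrow> v 2 = 0 \<and> v (i + 3) = 0 \<and> v (i + j + 4) = 0 \<and>
     (\<forall>n\<in>{3..i + 2} \<union> {i + 4..i + j + 3}. 0 < v n)"

lemma prob_zero_pattern_stationary:
  assumes "i + j + 5 \<le> k" "0 \<le> t"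
  shows "prob {\<omega> \<in> space P. zero_pattern i j (M t \<omega>)} = prob {\<omega> \<in> space P. zero_pattern i j (M 0 \<omega>)}"
    and "{\<omega> \<in> space P. zero_pattern i j (M t \<omega>)} \<in> events"
proof -
  let ?S = "{v \<in> space (mass_space k). zero_pattern i j v}"
  have comp: "(\<lambda>v. v x) \<in> borel_measurable (mass_space k)" if "x \<in> {1..k}" for x
    using that by (rule measurable_component_singleton)
  have S: "?S \<in> sets (mass_space k)"
  proof -
    have idx: "2 \<in> {1..k}" "i + 3 \<in> {1..k}" "i + j + 4 \<in> {1..k}" using assms(1) by auto
    note [measurable] = idx[THEN comp]
    have pos: "Measurable.pred (mass_space k) (\<lambda>v. 0 < v x)" if "x \<in> {1..k}" for x
    proof -
      note [measurable] = comp[OF that]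
      show ?thesis by measurable
    qed
    have [measurable]: "Measurable.pred (mass_space k) (\<lambda>v. \<forall>n\<in>{3..i + 2} \<union> {i + 4..i + j + 3}. 0 < v n)"
      using assms(1) by (intro pred_intros_finite pos) auto
    show ?thesis unfolding zero_pattern_def by measurable
  qed
  have cong: "zero_pattern i j (restrict v {1..k}) = zero_pattern i j v" for v
    using assms(1) unfolding zero_pattern_def by auto
  have vim: "(\<lambda>\<omega>. restrict (M t \<omega>) {1..k}) -` ?S \<inter> space P = {\<omega> \<in> space P. zero_pattern i j (M t \<omega>)}"
    if "0 \<le> t" for t
    using cong by (auto simp: space_PiM)
  have eq: "prob {\<omega> \<in> space P. zero_pattern i j (M t \<omega>)} = measure Q ?S" if t: "0 \<le> t" for t
    using measure_distr[OF measurable_M[OF t] S] unfolding stationary[OF t] vim[OF t] by simp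
  show "prob {\<omega> \<in> space P. zero_pattern i j (M t \<omega>)} = prob {\<omega> \<in> space P. zero_pattern i j (M 0 \<omega>)}"
    using eq assms(2) by simp
  show "{\<omega> \<in> space P. zero_pattern i j (M t \<omega>)} \<in> events"
    using measurable_sets[OF measurable_M[OF assms(2)] S] unfolding vim[OF assms(2)] .
qed

text \<open>
  During the first \<open>2 * k - 1\<close> windows of length \<open>h\<close> every edge gets a positive end,
  and a hit of every vertex in the remaining window makes the last hits decide which vertices are empty at time \<open>t\<close>.
\<close>
lemma zero_pattern_iff_peaks:
  assumes ijk: "i + j + 5 \<le> k" and h: "0 \<le> h"
    and path: "regular_meteor_path k (\<lambda>j t. N j t \<omega>) (\<lambda>t. M t \<omega>)"
    and mass: "(\<Sum>j=1..k. M 0 \<omega> j) = real k"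
    and act: "\<And>r x. r < 2 * k \<Longrightarrow> x \<in> {1..k} \<Longrightarrow> N x (real r * h) \<omega> \<noteq> N x (real (Suc r) * h) \<omega>"
  defines "t \<equiv> real (2 * k) * h"
  shows "zero_pattern i j (M t \<omega>) \<longleftrightarrow> three_peaks i j (\<lambda>x\<in>{1..i + j + 5}. hit_level t (\<lambda>s. N x s \<omega>))"
proof -
  interpret regular_meteor_path k "\<lambda>j t. N j t \<omega>" "\<lambda>t. M t \<omega>" by (rule path)
  let ?a = "real (2 * k - 1) * h" and ?U = "\<lambda>x. hit_level t (\<lambda>s. N x s \<omega>)"
  have "\<exists>y\<in>{1..k}. 0 < M 0 \<omega> y"
  proof (rule ccontr)
    assume "\<not> ?thesis"
    then have "(\<Sum>j=1..k. M 0 \<omega> j) \<le> 0" by (intro sum_nonpos) force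
    then show False using mass k3 by simp
  qed
  then have iso: "isolated_if_empty ?a x" if "x \<in> {1..k}" for x
    using eventually_isolated[OF h _ act that] by blast
  have at: "0 \<le> ?a" "?a \<le> t" using h by (auto simp: t_def intro!: mult_right_mono)
  have "Suc (2 * k - 1) = 2 * k" using k3 by simp
  then have act': "N z ?a \<omega> \<noteq> N z t \<omega>" if "z \<in> {1..k}" for z
    using act[of "2 * k - 1" z] that k3 by (simp add: t_def)
  have zero: "M t \<omega> x = 0 \<longleftrightarrow> is_peak ?U x" if "2 \<le> x" "x \<le> i + j + 4" for x
  proof -
    have x: "x \<in> {1..k}" "1 < x" "x < k" using that ijk by auto
    have "M t \<omega> x = 0 \<longleftrightarrow> (\<forall>z\<in>neighbors k x. last_hit t (\<lambda>s. N z s \<omega>) < last_hit t (\<lambda>s. N x s \<omega>))"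
      by (rule empty_iff_hit_last[OF at x(1) iso[OF x(1)] act'])
    then show ?thesis
      unfolding neighbors_interior[OF x(2,3)] by (simp add: is_peak_def hit_level_def)
  qed
  have pos: "0 < M t \<omega> x \<longleftrightarrow> \<not> is_peak ?U x" if "2 \<le> x" "x \<le> i + j + 4" for x
  proof -
    have "0 \<le> M t \<omega> x" using that ijk at by (intro nonneg) auto
    then show ?thesis using zero[OF that] by (auto simp: order_less_le)
  qed
  have "zero_pattern i j (M t \<omega>) \<longleftrightarrow> three_peaks i j ?U"
  proof -
    have "(\<forall>x\<in>{3..i + 2} \<union> {i + 4..i + j + 3}. 0 < M t \<omega> x) \<longleftrightarrow>
        (\<forall>x\<in>{3..i + 2} \<union> {i + 4..i + j + 3}. \<not> is_peak ?U x)"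
      by (intro ball_cong refl pos) auto
    then show ?thesis unfolding zero_pattern_def three_peaks_def by (simp add: zero)
  qed
  also have "\<dots> \<longleftrightarrow> three_peaks i j (\<lambda>x\<in>{1..i + j + 5}. ?U x)"
    by (rule three_peaks_cong) simp
  finally show ?thesis .
qed

text \<open>
  The pattern at time \<open>2 * k * h\<close> has the same probability as at time \<open>0\<close>. The error is the probability
  \<open>exp (- h)\<close> of no hit, once for each of the \<open>k\<close> vertices and \<open>2 * k\<close> windows, and the error of
  \<open>unif_prod_max_close\<close>.
\<close>
lemma prob_zero_pattern_close:
  assumes ijk: "i + j + 5 \<le> k" and h: "0 < h"
  shows "\<bar>prob {\<omega> \<in> space P. zero_pattern i j (M 0 \<omega>)}
      - measure (unif_prod {1..i + j + 5}) {w \<in> space (unif_prod {1..i + j + 5}). three_peaks i j w}\<bar>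
      \<le> real (2 * k * k + k) * exp (- h)"
proof -
  let ?I = "{1..i + j + 5}"
  define t where "t = real (2 * k) * h"
  have t: "0 \<le> t" using h by (simp add: t_def)
  let ?A = "{\<omega> \<in> space P. zero_pattern i j (M t \<omega>)}"
  let ?B = "{\<omega> \<in> space P. three_peaks i j (\<lambda>x\<in>?I. hit_level t (\<lambda>s. N x s \<omega>))}"
  let ?C = "\<lambda>(r, x). {\<omega> \<in> space P. N x (real r * h) \<omega> = N x (real (Suc r) * h) \<omega>}"
  let ?J = "{..<2 * k} \<times> {1..k}"
  have R: "Measurable.pred (unif_prod ?I) (three_peaks i j)"
    by (rule pred_three_peaks) simp
  have I: "?I \<subseteq> {1..k}" "?I \<noteq> {}" using ijk by auto
  have C: "?C p \<in> events" "prob (?C p) = exp (- h)" if "p \<in> ?J" for p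
  proof -
    obtain r x where p: "p = (r, x)" "x \<in> {1..k}" using \<open>p \<in> ?J\<close> by auto
    interpret poisson_process P 1 "N x" using poisson p by simp
    have rr: "0 \<le> real r * h" "real r * h < real (Suc r) * h" "0 \<le> real (Suc r) * h"
      using h by (auto intro!: mult_strict_right_mono)
    show "?C p \<in> events" using event_no_hit[OF rr(1,3)] by (simp add: p)
    have "real (Suc r) * h - real r * h = h" by (simp add: algebra_simps)
    then show "prob (?C p) = exp (- h)" using prob_no_hit[OF rr(1,2)] by (simp add: p)
  qed
  have "\<bar>prob ?A - prob ?B\<bar> \<le> prob (\<Union>p\<in>?J. ?C p)"
  proof (rule measure_diff_le_AE)
    show "?A \<in> events" by (rule prob_zero_pattern_stationary(2)[OF ijk t])
    show "?B \<in> events" by (rule prob_hit_levels(2)[OF t I R])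
    show "(\<Union>p\<in>?J. ?C p) \<in> events" using C(1) by (intro sets.finite_UN) auto
    have "AE \<omega> in P. \<forall>j\<in>{1..k}. counting_path (\<lambda>t. N j t \<omega>)"
      by (intro AE_finite_allI poisson_process.AE_counting_path[OF poisson]) simp_all
    then show "AE \<omega> in P. \<omega> \<notin> (\<Union>p\<in>?J. ?C p) \<longrightarrow> (\<omega> \<in> ?A) = (\<omega> \<in> ?B)"
      using nonneg_initial evolution total_mass AE_space
    proof eventually_elim
      case (elim \<omega>)
      show ?case
      proof
        assume notC: "\<omega> \<notin> (\<Union>p\<in>?J. ?C p)"
        have "regular_meteor_path k (\<lambda>j t. N j t \<omega>) (\<lambda>t. M t \<omega>)"
          using elim k_ge_3 by unfold_locales auto
        moreover have "N x (real r * h) \<omega> \<noteq> N x (real (Suc r) * h) \<omega>" if "r < 2 * k" "x \<in> {1..k}" for r x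
          using notC that elim(5) by force
        ultimately have "zero_pattern i j (M t \<omega>) \<longleftrightarrow> three_peaks i j (\<lambda>x\<in>?I. hit_level t (\<lambda>s. N x s \<omega>))"
          using zero_pattern_iff_peaks[OF ijk, of h \<omega>] h elim(4) unfolding t_def by simp
        then show "(\<omega> \<in> ?A) = (\<omega> \<in> ?B)" by simp
      qed
    qed
  qed
  also have "\<dots> \<le> (\<Sum>p\<in>?J. prob (?C p))"
    using C(1) by (intro finite_measure_subadditive_finite) auto
  also have "\<dots> = (\<Sum>p\<in>?J. exp (- h))" by (intro sum.cong refl C(2))
  also have "\<dots> = real (2 * k * k) * exp (- h)" by simp
  finally have 1: "\<bar>prob ?A - prob ?B\<bar> \<le> real (2 * k * k) * exp (- h)" .
  have "\<bar>prob ?B - measure (unif_prod ?I) {w \<in> space (unif_prod ?I). three_peaks i j w}\<bar> \<le> real (card ?I) * exp (- t)"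
    unfolding prob_hit_levels(1)[OF t I R] using t by (intro unif_prod_max_close R) auto
  also have "\<dots> \<le> real k * exp (- h)"
  proof (intro mult_mono)
    have "1 * h \<le> t" unfolding t_def using h k_ge_3 by (intro mult_right_mono) auto
    then show "exp (- t) \<le> exp (- h)" by simp
  qed (use ijk in auto)
  finally have 2: "\<bar>prob ?B - measure (unif_prod ?I) {w \<in> space (unif_prod ?I). three_peaks i j w}\<bar> \<le> real k * exp (- h)" .
  have "real (2 * k * k + k) * exp (- h) = real (2 * k * k) * exp (- h) + real k * exp (- h)"
    by (simp add: distrib_right)
  then show ?thesis using 1 2 prob_zero_pattern_stationary(1)[OF ijk t] by linarith
qed

lemma prob_zero_pattern:
  assumes ijk: "i + j + 5 \<le> k"
  shows "prob {\<omega> \<in> space P. zero_pattern i j (M 0 \<omega>)}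
      = measure (unif_prod {1..i + j + 5}) {w \<in> space (unif_prod {1..i + j + 5}). three_peaks i j w}"
    (is "?p = ?q")
proof -
  let ?c = "real (2 * k * k + k)"
  have "((\<lambda>h::real. ?c * exp (- h)) \<longlongrightarrow> ?c * 0) at_top"
    by (intro tendsto_intros filterlim_compose[OF exp_at_bot] filterlim_uminus_at_bot_at_top)
  moreover have "\<forall>\<^sub>F h in at_top. \<bar>?p - ?q\<bar> \<le> ?c * exp (- h)"
    using eventually_gt_at_top[of 0] by eventually_elim (rule prob_zero_pattern_close[OF ijk])
  ultimately have "\<bar>?p - ?q\<bar> \<le> ?c * 0"
    by (intro tendsto_lowerbound[where f = "\<lambda>h. ?c * exp (- h)" and F = at_top]) auto
  then show ?thesis by simp
qed

end

theorem theorem4p2: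
  fixes P :: "'a measure" and k i j :: nat
    and N :: "nat \<Rightarrow> real \<Rightarrow> 'a \<Rightarrow> nat"
    and M :: "real \<Rightarrow> 'a \<Rightarrow> nat \<Rightarrow> real"
    and Q :: "(nat \<Rightarrow> real) measure"
  assumes "stationary_meteor_process P k N M Q"
    and "i \<ge> 1" and "j \<ge> 1" and "k \<ge> i + j + 5"
  shows "measure P {\<omega> \<in> space P.
            M 0 \<omega> 2 = 0 \<and> M 0 \<omega> (i + 3) = 0 \<and> M 0 \<omega> (i + j + 4) = 0 \<and>
            (\<forall>n \<in> {3..i + 2} \<union> {i + 4..i + j + 3}. M 0 \<omega> n > 0)}
         = 2 ^ (i + j) / fact (i + j + 5) *
           (real (i + j + 4) *
              (real j * real ((i + j + 1) choose (i - 1))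
               + real (j + 1) * real ((i + j + 1) choose i)
               + real (i + 1) * real ((i + j + 1) choose (i + 1))
               + real i * real ((i + j + 1) choose (i + 2))
               - 2 * real (i + j + 1))
            + real i * real j * real ((i + j + 4) choose (i + 2)))"
proof -
  interpret stationary_meteor_process P k N M Q by fact
  show ?thesis
    using prob_zero_pattern[OF assms(4)]
    unfolding zero_pattern_def measure_three_peaks[OF assms(2,3)]
      integral_unique[OF has_integral_side_vol_product[OF assms(2,3)]] .
qed

end
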